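(* For every bivariate copula $C$ there is a sequence $(C_n)_{n\in\mathbb{N}}$ of elements of $\mathcal{S}$ (the class of all checkerboard copulas) that converges to $C$ with respect to weak conditional convergence, i.e. $C_n \xrightarrow{\mathrm{wcc}} C$. In other words, $\mathcal{S}$ is dense in the family $\mathcal{C}$ of all bivariate copulas with respect to weak conditional convergence.
   Context: $\mathcal{C}$ denotes the family of all bivariate copulas, $\lambda$ the Lebesgue measure on $[0,1]$. For $C\in\mathcal{C}$, $\mu_C$ denotes the corresponding doubly stochastic measure on $\mathcal{B}([0,1]^2)$, i.e. $\mu_C([0,x]\times[0,y])=C(x,y)$ for all $x,y\in[0,1]$. Markov kernel of a copula: $K_C:[0,1]\times\mathcal{B}([0,1])\to[0,1]$ denotes (a version of) the regular conditional distribution of $Y$ given $X$, where $(X,Y)$ has distribution function $C$; that is, $x\mapsto K_C(x,E)$ is measurable for every Borel set $E$, $K_C(x,\cdot)$ is a probability measure for every $x$, and $\int_{[0,1]}K_C(x,G_x)\,d\lambda(x)=\mu_C(G)$ for all $G\in\mathcal{B}([0,1]^2)$, where $G_x=\{y:(x,y)\in G\}$. It is unique for $\lambda$-almost every $x$. Weak conditional convergence: for copulas $C,C_1,C_2,\ldots$ with (versions of) Markov kernels $K_C,K_{C_1},K_{C_2},\ldots$, one writes $C_n\xrightarrow{\mathrm{wcc}}C$ if and only if for $\lambda$-almost every $x\in[0,1]$ the sequence $(K_{C_n}(x,\cdot))_{n\in\mathbb{N}}$ of probability measures on $\mathcal{B}([0,1])$ converges weakly to $K_C(x,\cdot)$.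 Checkerboard copulas: a copula $C$ is a checkerboard copula with resolution $N\in\mathbb{N}$ if $\mu_C$ distributes its mass uniformly on each square $R_{ij}^N=[\frac{i-1}{N},\frac{i}{N}]\times[\frac{j-1}{N},\frac{j}{N}]$, $i,j\in\{1,\ldots,N\}$. $\mathcal{S}_N$ is the family of all checkerboard copulas with resolution $N$ and $\mathcal{S}=\bigcup_{N=1}^\infty\mathcal{S}_N$. *)

theory Defs
  imports "HOL-Probability.Probability"
begin

text \<open>Copulas are represented by functions on the plane; only the values on the closed unit
  square are constrained or used.\<close>

definition copula :: "(real \<Rightarrow> real \<Rightarrow> real) \<Rightarrow> bool" where
  "copula C \<longleftrightarrow>
    (\<forall>t\<in>{0..1}. C t 0 = 0 \<and> C 0 t = 0 \<and> C t 1 = t \<and> C 1 t = t) \<and>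
    (\<forall>x1 x2 y1 y2. 0 \<le> x1 \<and> x1 \<le> x2 \<and> x2 \<le> 1 \<and> 0 \<le> y1 \<and> y1 \<le> y2 \<and> y2 \<le> 1 \<longrightarrow>
      0 \<le> C x2 y2 - C x1 y2 - C x2 y1 + C x1 y1)"

abbreviation unit_borel :: "real measure" where
  "unit_borel \<equiv> restrict_space borel {0..1}"

abbreviation unit_square_borel :: "(real \<times> real) measure" where
  "unit_square_borel \<equiv> restrict_space borel ({0..1} \<times> {0..1})"

abbreviation unit_lebesgue :: "real measure" where
  "unit_lebesgue \<equiv> restrict_space lborel {0..1}"

text \<open>The rectangles anchored at the origin form a generating \<open>\<pi>\<close>-system containing the whole
  square, so for a copula the measure described below is unique; it is doubly stochastic because
  of the uniform margins.\<close>

definition copula_measure :: "(real \<Rightarrow> real \<Rightarrow> real) \<Rightarrow> (real \<times> real) measure" where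
  "copula_measure C = (THE M. sets M = sets unit_square_borel \<and>
    (\<forall>x\<in>{0..1}. \<forall>y\<in>{0..1}. emeasure M ({0..x} \<times> {0..y}) = ennreal (C x y)))"

text \<open>Membership in the first conjunct says exactly that every \<open>K x\<close> with \<open>x\<close> in the unit
  interval is a Borel probability measure on the unit interval, and that
  \<open>x \<mapsto> K x E\<close> is measurable for every Borel set \<open>E\<close>.\<close>

definition markov_kernel :: "(real \<Rightarrow> real \<Rightarrow> real) \<Rightarrow> (real \<Rightarrow> real measure) \<Rightarrow> bool" where
  "markov_kernel C K \<longleftrightarrow>
    K \<in> unit_borel \<rightarrow>\<^sub>M prob_algebra unit_borel \<and>
    (\<forall>G\<in>sets unit_square_borel.
      (\<integral>\<^sup>+ x. emeasure (K x) {y. (x, y) \<in> G} \<partial>unit_lebesgue) = emeasure (copula_measure C) G)"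

text \<open>\<^const>\<open>weak_conv_m\<close> is meant for probability measures on the Borel sets of the whole real line,
  hence the push-forward along the inclusion of the unit interval. Kernels are unique up to null
  sets of \<open>x\<close>, so it does not matter which versions are taken; the existential form makes their
  existence part of the assertion.\<close>

definition wcc :: "(nat \<Rightarrow> real \<Rightarrow> real \<Rightarrow> real) \<Rightarrow> (real \<Rightarrow> real \<Rightarrow> real) \<Rightarrow> bool" where
  "wcc Cs C \<longleftrightarrow> (\<exists>K Ks. markov_kernel C K \<and> (\<forall>n. markov_kernel (Cs n) (Ks n)) \<and>
    (AE x in unit_lebesgue.
      weak_conv_m (\<lambda>n. distr (Ks n x) borel (\<lambda>y. y)) (distr (K x) borel (\<lambda>y. y))))"

definition grid_square :: "nat \<Rightarrow> nat \<Rightarrow> nat \<Rightarrow> (real \<times> real) set" where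
  "grid_square N i j =
    {(real i - 1) / real N .. real i / real N} \<times> {(real j - 1) / real N .. real j / real N}"

definition checkerboard_copulas_res :: "nat \<Rightarrow> (real \<Rightarrow> real \<Rightarrow> real) set" where
  "checkerboard_copulas_res N = {C. copula C \<and>
    (\<forall>i\<in>{1..N}. \<forall>j\<in>{1..N}. \<forall>A\<in>sets borel. A \<subseteq> grid_square N i j \<longrightarrow>
      emeasure (copula_measure C) A =
        emeasure (copula_measure C) (grid_square N i j) *
        emeasure (uniform_measure lborel (grid_square N i j)) A)}"

definition checkerboard_copulas :: "(real \<Rightarrow> real \<Rightarrow> real) set" where
  "checkerboard_copulas = (\<Union>N\<in>{1..}. checkerboard_copulas_res N)"

end

theory Submission
  imports Defs "HOL-Library.Diagonal_Subsequence"
begin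

text \<open>The approximants of a copula \<open>C\<close> are its own checkerboard discretizations: \<open>checkerboard C N\<close>
  redistributes the mass that \<open>C\<close> gives to each square of the \<open>N \<times> N\<close> grid uniformly over that
  square. Its Markov kernel \<open>checkerboard_kernel C N\<close> is explicit, and for a height \<open>y\<close> on the grid
  the mass that it puts on \<open>{0..y}\<close> is the difference quotient
  \<open>slope C N x y = N * (C ((i + 1) / N) y - C (i / N) y)\<close> over the grid cell \<open>i\<close> that contains \<open>x\<close>.
  So the theorem amounts to the almost sure convergence of these difference quotients in \<open>x\<close> for
  countably many heights \<open>y\<close>, together with the construction of a kernel of \<open>C\<close> from the limits.

  For fixed \<open>y\<close> the slopes take values in the unit interval and form a martingale along any sequence
  of resolutions each of which divides the next: the finer slope averages to the coarser one on every
  coarse cell (\<open>integral_slope_mult_refine\<close>). Only the Hilbert space part of martingale theory is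
  used: increments are orthogonal, so the second moments increase to a finite limit and the slopes
  are Cauchy in mean (\<open>bounded_orthogonal_increments_L1_Cauchy\<close>). A subsequence then converges
  almost surely, and a diagonal argument yields one subsequence for all rational \<open>y\<close>. The
  theorem leaves the choice of the resolutions free, so passing to a subsequence costs nothing. The
  resolutions are factorials: each divides the later ones, and every rational in the unit interval
  eventually lies on the grid.

  For every \<open>x\<close> the upper limit of the slopes is monotone in \<open>y\<close>, so its right-continuous
  regularization is a distribution function; the corresponding measures form \<open>limit_kernel\<close>. Dominated
  convergence identifies the integrals of the limits for rational \<open>y\<close>, and since a copula is
  Lipschitz a squeeze between rationals shows that \<open>limit_kernel\<close> is a Markov kernel of \<open>C\<close>
  (\<open>markov_kernel_limit_kernel\<close>). This also proves that \<open>C\<close> has a kernel at all, and hence a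
  measure. Convergence of distribution functions at all rationals to values that interlace with
  the regularization gives weak convergence (\<open>weak_conv_rational\<close>).\<close>

section \<open>Copula measures and Markov kernels\<close>

lemma prob_space_unit_lebesgue: "prob_space unit_lebesgue"
  by (rule prob_spaceI) (simp add: emeasure_restrict_space space_restrict_space)

lemma sets_unit_lebesgue: "sets unit_lebesgue = sets unit_borel"
  by (intro sets_restrict_space_cong) simp

lemma sets_unit_square_borel: "sets (unit_borel \<Otimes>\<^sub>M unit_borel) = sets unit_square_borel"
proof (intro subset_antisym)
  have "A \<times> B \<in> sets unit_square_borel" if "A \<in> sets unit_borel" "B \<in> sets unit_borel" for A B
  proof -
    from that have "A \<in> sets borel" "A \<subseteq> {0..1}" "B \<in> sets borel" "B \<subseteq> {0..1}"
      by (auto simp: sets_restrict_space_iff)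
    moreover from this have "A \<times> B \<in> sets (borel :: (real \<times> real) measure)"
      unfolding borel_prod[symmetric] by (intro pair_measureI)
    ultimately show ?thesis
      by (auto simp: sets_restrict_space_iff borel_closed closed_Times)
  qed
  then show "sets (unit_borel \<Otimes>\<^sub>M unit_borel) \<subseteq> sets unit_square_borel"
    unfolding sets_pair_measure
    by (intro sets.sigma_sets_subset') (auto simp: space_restrict_space sets_restrict_space_iff borel_closed closed_Times)
next
  have id: "(\<lambda>p. (fst p, snd p)) \<in> unit_borel \<Otimes>\<^sub>M unit_borel \<rightarrow>\<^sub>M (borel \<Otimes>\<^sub>M borel :: (real \<times> real) measure)"
    by (intro measurable_Pair measurable_compose[OF measurable_fst] measurable_compose[OF measurable_snd]
        measurable_restrict_space1) auto
  show "sets unit_square_borel \<subseteq> sets (unit_borel \<Otimes>\<^sub>M unit_borel)"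
  proof
    fix G assume "G \<in> sets unit_square_borel"
    then obtain X where X: "X \<in> sets (borel \<Otimes>\<^sub>M borel :: (real \<times> real) measure)" "G = ({0..1} \<times> {0..1}) \<inter> X"
      unfolding sets_restrict_space borel_prod by auto
    from measurable_sets[OF id X(1)] X(2) show "G \<in> sets (unit_borel \<Otimes>\<^sub>M unit_borel)"
      by (simp add: space_pair_measure space_restrict_space Int_commute)
  qed
qed

text \<open>Lower left rectangles, together with the empty set, are the traces on the square of the sets
  \<open>{..p}\<close>, which generate the Borel sets and are closed under intersection. Hence a measure with the
  prescribed values is unique, and the definite description in \<^const>\<open>copula_measure\<close> denotes it
  as soon as one such measure is exhibited.\<close>

lemma copula_measure_eqI:
  assumes sets: "sets M = sets unit_square_borel"
    and rect: "\<And>x y. x \<in> {0..1} \<Longrightarrow> y \<in> {0..1} \<Longrightarrow> emeasure M ({0..x} \<times> {0..y}) = ennreal (C x y)"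
  shows "copula_measure C = M"
  unfolding copula_measure_def
proof (rule the_equality)
  show "sets M = sets unit_square_borel \<and>
    (\<forall>x\<in>{0..1}. \<forall>y\<in>{0..1}. emeasure M ({0..x} \<times> {0..y}) = ennreal (C x y))"
    using assms by auto
next
  fix M' :: "(real \<times> real) measure"
  let ?S = "{0..1::real} \<times> {0..1::real}"
  assume M': "sets M' = sets unit_square_borel \<and>
    (\<forall>x\<in>{0..1}. \<forall>y\<in>{0..1}. emeasure M' ({0..x} \<times> {0..y}) = ennreal (C x y))"
  let ?E = "(\<inter>) ?S ` range (\<lambda>a::real \<times> real. {..a})"
  have gen: "sets unit_square_borel = sigma_sets ?S ?E"
  proof -
    have borel: "sets (borel :: (real \<times> real) measure) = sigma_sets UNIV (range (\<lambda>a. {..a}))"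
      unfolding borel_eq_atMost by simp
    have "?S \<in> sets borel" by (simp add: borel_closed closed_Times)
    then show ?thesis
      unfolding sets_restrict_space borel by (intro sigma_sets_Int) auto
  qed
  show "M' = M"
  proof (rule measure_eqI_generator_eq[where \<Omega>="?S" and E="?E" and A="\<lambda>_. ?S"])
    show "Int_stable ?E"
    proof (rule Int_stableI)
      fix X Y assume "X \<in> ?E" "Y \<in> ?E"
      then obtain p q where "X = ?S \<inter> {..p}" "Y = ?S \<inter> {..q}" by auto
      then have "X \<inter> Y = ?S \<inter> {..inf p q}" by auto
      then show "X \<inter> Y \<in> ?E" by blast
    qed
    show "emeasure M' X = emeasure M X" if "X \<in> ?E" for X
    proof -
      from that obtain a b where X: "X = ?S \<inter> {..(a, b)}" by auto
      show ?thesis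
      proof (cases "0 \<le> a \<and> 0 \<le> b")
        case True
        then have "X = {0..min a 1} \<times> {0..min b 1}" using X by auto
        then show ?thesis using M' rect[of "min a 1" "min b 1"] True by simp
      next
        case False
        then have "X = {}" using X by auto
        then show ?thesis by simp
      qed
    qed
    have "?S = ?S \<inter> {..(1, 1)}" by auto
    then show "range (\<lambda>_. ?S) \<subseteq> ?E" by blast
    show "emeasure M' ?S \<noteq> \<infinity>"
      using M' by (metis atLeastAtMost_iff ennreal_neq_top infinity_ennreal_def order_refl zero_le_one)
  qed (use sets M' gen in auto)
qed

text \<open>Integrating the kernel against Lebesgue measure produces a measure on the square; the assumption says
  that it has the right values on rectangles, so it is the measure of \<open>C\<close>. In this way a kernel
  proves the existence of the copula measure together with its disintegration.\<close>

lemma markov_kernelI: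
  assumes K: "K \<in> unit_borel \<rightarrow>\<^sub>M prob_algebra unit_borel"
    and C: "\<And>s y. s \<in> {0..1} \<Longrightarrow> y \<in> {0..1} \<Longrightarrow>
      (\<integral>\<^sup>+ t\<in>{0..s}. emeasure (K t) {0..y} \<partial>unit_lebesgue) = ennreal (C s y)"
  shows "markov_kernel C K"
proof -
  let ?P = "unit_borel \<Otimes>\<^sub>M unit_borel"
  let ?J = "\<lambda>x. distr (K x) ?P (Pair x)"
  define M where "M = unit_lebesgue \<bind> ?J"
  have J: "?J \<in> unit_lebesgue \<rightarrow>\<^sub>M prob_algebra ?P"
    using measurable_distr_prob_space2[OF K, of Pair ?P]
    by (simp add: measurable_cong_sets[OF sets_unit_lebesgue refl])
  have M: "emeasure M G = (\<integral>\<^sup>+ x. emeasure (K x) {y. (x, y) \<in> G} \<partial>unit_lebesgue)"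
    if G: "G \<in> sets unit_square_borel" for G
  proof -
    have "emeasure M G = (\<integral>\<^sup>+ x. emeasure (?J x) G \<partial>unit_lebesgue)"
      unfolding M_def using G
      by (intro emeasure_bind[OF _ measurable_prob_algebraD[OF J]])
        (auto simp: sets_unit_square_borel space_restrict_space)
    also have "\<dots> = (\<integral>\<^sup>+ x. emeasure (K x) {y. (x, y) \<in> G} \<partial>unit_lebesgue)"
    proof (rule nn_integral_cong)
      fix x assume "x \<in> space unit_lebesgue"
      then have x: "x \<in> space unit_borel" by (simp add: space_restrict_space)
      have sets: "sets (K x) = sets unit_borel"
        using measurable_space[OF K x] by (simp add: space_prob_algebra)
      have "Pair x \<in> K x \<rightarrow>\<^sub>M ?P"
        using x by (simp add: measurable_cong_sets[OF sets refl])
      moreover have "Pair x -` G \<inter> space (K x) = {y. (x, y) \<in> G}"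
        using sets.sets_into_space[OF G] sets_eq_imp_space_eq[OF sets] by (auto simp: space_restrict_space)
      ultimately show "emeasure (?J x) G = emeasure (K x) {y. (x, y) \<in> G}"
        using G by (simp add: emeasure_distr sets_unit_square_borel)
    qed
    finally show ?thesis .
  qed
  have setsM: "sets M = sets unit_square_borel"
    unfolding M_def sets_unit_square_borel[symmetric]
    by (rule sets_bind) (auto simp: space_restrict_space)
  have "copula_measure C = M"
  proof (rule copula_measure_eqI[OF setsM])
    fix x y :: real assume x: "x \<in> {0..1}" and y: "y \<in> {0..1}"
    have "{0..x} \<times> {0..y} \<in> sets unit_square_borel"
      using x y by (auto simp: sets_restrict_space_iff borel_closed closed_Times)
    then have "emeasure M ({0..x} \<times> {0..y}) =
        (\<integral>\<^sup>+ t. emeasure (K t) {y'. (t, y') \<in> {0..x} \<times> {0..y}} \<partial>unit_lebesgue)"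
      by (rule M)
    also have "\<dots> = (\<integral>\<^sup>+ t\<in>{0..x}. emeasure (K t) {0..y} \<partial>unit_lebesgue)"
    proof (rule nn_integral_cong)
      fix t
      have "{y'. (t, y') \<in> {0..x} \<times> {0..y}} = (if t \<in> {0..x} then {0..y} else {})" by auto
      then show "emeasure (K t) {y'. (t, y') \<in> {0..x} \<times> {0..y}} = emeasure (K t) {0..y} * indicator {0..x} t"
        by simp
    qed
    also have "\<dots> = ennreal (C x y)" using x y by (rule C)
    finally show "emeasure M ({0..x} \<times> {0..y}) = ennreal (C x y)" .
  qed
  then show ?thesis unfolding markov_kernel_def using K M by simp
qed

section \<open>The uniform grid on the unit interval\<close>

text \<open>The minimum assigns the right end point \<open>1\<close> to the last cell, so that every point of the closed
  unit interval has a cell with index below \<open>N\<close>.\<close>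

definition cell :: "nat \<Rightarrow> real \<Rightarrow> nat" where
  "cell N x = min (N - 1) (nat \<lfloor>real N * x\<rfloor>)"

lemma cell_less: "0 < N \<Longrightarrow> cell N x < N"
  by (simp add: cell_def)

lemma measurable_cell [measurable]: "cell N \<in> borel \<rightarrow>\<^sub>M count_space UNIV"
  unfolding cell_def by measurable

lemma cell_eq_iff:
  assumes "0 < N" "0 \<le> x" "x < 1"
  shows "cell N x = i \<longleftrightarrow> real i / real N \<le> x \<and> x < (real i + 1) / real N"
proof -
  have "real N * x < real N" using assms by simp
  then have "\<lfloor>real N * x\<rfloor> < int N" by linarith
  then have "cell N x = nat \<lfloor>real N * x\<rfloor>" by (simp add: cell_def)
  also have "\<dots> = i \<longleftrightarrow> \<lfloor>real N * x\<rfloor> = int i" using assms by (auto simp: nat_eq_iff)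
  also have "\<dots> \<longleftrightarrow> real i \<le> real N * x \<and> real N * x < real i + 1"
    by (simp add: floor_eq_iff)
  finally show ?thesis using assms by (simp add: field_simps)
qed

text \<open>The cell with index \<open>i\<close> of the finer grid lies in the cell with index \<open>i div k\<close> of the coarser one.\<close>

lemma cell_div:
  assumes "0 < N" "0 < k" "0 \<le> x" "x < 1"
  shows "cell (N * k) x div k = cell N x"
proof -
  let ?i = "cell (N * k) x"
  have "real ?i / real (N * k) \<le> x" "x < (real ?i + 1) / real (N * k)"
    using cell_eq_iff[of "N * k" x ?i] assms by auto
  then have i: "real ?i \<le> x * real N * real k" "x * real N * real k < real ?i + 1"
    using assms by (auto simp: field_simps)
  have "real (?i div k * k) \<le> real ?i" by (metis div_times_less_eq_dividend of_nat_mono)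
  with i have "real (?i div k) * real k \<le> x * real N * real k" by simp
  then have "real (?i div k) \<le> x * real N" using assms by simp
  moreover have "?i + 1 \<le> (?i div k + 1) * k"
    using dividend_less_div_times[of k ?i] assms(2) by (simp add: algebra_simps)
  then have "real (?i + 1) \<le> real ((?i div k + 1) * k)" by (rule of_nat_mono)
  with i have "x * real N * real k < (real (?i div k) + 1) * real k" by (simp add: algebra_simps)
  then have "x * real N < real (?i div k) + 1" using assms by simp
  ultimately show ?thesis
    using cell_eq_iff[of N x "?i div k"] assms by (simp add: field_simps)
qed

lemma AE_unit_lebesgue_neq: "AE x in unit_lebesgue. x \<noteq> c"
  using AE_lborel_singleton[of c] by (auto simp: AE_restrict_space_iff)

lemma sets_cell: "{x\<in>{0..1}. cell N x = i} \<in> sets unit_lebesgue"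
proof -
  have "{x\<in>{0..1::real}. cell N x = i} \<in> sets borel" by measurable
  then show ?thesis by (auto simp: sets_restrict_space_iff)
qed

lemma measure_cell:
  assumes N: "0 < N" and i: "i < N"
  shows "measure unit_lebesgue {x\<in>{0..1}. cell N x = i} = 1 / real N"
proof -
  interpret prob_space unit_lebesgue by (rule prob_space_unit_lebesgue)
  have "real i + 1 \<le> real N" using i by linarith
  then have "(real i + 1) / real N \<le> 1" using N by simp
  moreover have "0 \<le> real i / real N" by simp
  ultimately have sub: "{real i / real N..<(real i + 1) / real N} \<subseteq> {0..1}"
    unfolding subset_iff atLeastLessThan_iff atLeastAtMost_iff by linarith
  have "measure unit_lebesgue {x\<in>{0..1}. cell N x = i}
      = measure unit_lebesgue {real i / real N..<(real i + 1) / real N}"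
  proof (rule finite_measure_eq_AE)
    show "AE x in unit_lebesgue. x \<in> {x \<in> {0..1}. cell N x = i} \<longleftrightarrow> x \<in> {real i / real N..<(real i + 1) / real N}"
      using AE_unit_lebesgue_neq[of 1] AE_space
    proof eventually_elim
      case (elim x)
      then show ?case using cell_eq_iff[OF N, of x i] by (auto simp: space_restrict_space)
    qed
    show "{x \<in> {0..1}. cell N x = i} \<in> sets unit_lebesgue" by (rule sets_cell)
    show "{real i / real N..<(real i + 1) / real N} \<in> sets unit_lebesgue"
      using sub by (simp add: sets_restrict_space_iff)
  qed
  also have "\<dots> = measure lborel {real i / real N..<(real i + 1) / real N}"
    using sub by (intro measure_restrict_space) auto
  also have "\<dots> = (real i + 1) / real N - real i / real N"
    using N by (simp add: divide_right_mono)
  also have "\<dots> = 1 / real N" by (simp add: diff_divide_distrib[symmetric])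
  finally show ?thesis .
qed

lemma measurable_cell_fun [measurable]:
  "(\<lambda>x. h (cell N x)) \<in> borel_measurable unit_lebesgue"
  by (rule measurable_compose[of _ _ "count_space UNIV"]) (auto intro: measurable_restrict_space1)

lemma cell_sum:
  fixes h :: "nat \<Rightarrow> real"
  assumes N: "0 < N"
  shows "h (cell N x) = (\<Sum>i<N. h i * indicator {x. cell N x = i} x)"
proof -
  have "(\<Sum>i<N. h i * indicator {x. cell N x = i} x) = (\<Sum>i<N. if i = cell N x then h i else 0)"
    by (intro sum.cong) (auto simp: indicator_def)
  also have "\<dots> = h (cell N x)" using cell_less[OF N, of x] by simp
  finally show ?thesis by simp
qed

lemma
  fixes h :: "nat \<Rightarrow> real"
  assumes N: "0 < N"
  shows integrable_cell: "integrable unit_lebesgue (\<lambda>x. h (cell N x))"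
    and integral_cell: "(\<integral>x. h (cell N x) \<partial>unit_lebesgue) = (\<Sum>i<N. h i) / real N"
proof -
  interpret prob_space unit_lebesgue by (rule prob_space_unit_lebesgue)
  have eq: "h (cell N x) = (\<Sum>i<N. h i * indicator {x\<in>{0..1}. cell N x = i} x)"
    if "x \<in> space unit_lebesgue" for x
    using that unfolding cell_sum[OF N, of h x]
    by (intro sum.cong) (auto simp: indicator_def space_restrict_space)
  have int: "integrable unit_lebesgue (\<lambda>x. h i * indicator {x\<in>{0..1}. cell N x = i} x)" for i
    using sets_cell by (intro integrable_mult_right integrable_real_indicator) (auto simp: less_top[symmetric])
  show "integrable unit_lebesgue (\<lambda>x. h (cell N x))"
    by (subst Bochner_Integration.integrable_cong[OF refl eq])
      (assumption | intro Bochner_Integration.integrable_sum int)+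
  have "(\<integral>x. h (cell N x) \<partial>unit_lebesgue)
      = (\<integral>x. (\<Sum>i<N. h i * indicator {x\<in>{0..1}. cell N x = i} x) \<partial>unit_lebesgue)"
    by (rule Bochner_Integration.integral_cong[OF refl eq])
  also have "\<dots> = (\<Sum>i<N. h i * measure unit_lebesgue {x\<in>{0..1}. cell N x = i})"
  proof -
    have "{x\<in>{0..1}. cell N x = i} \<inter> space unit_lebesgue = {x\<in>{0..1}. cell N x = i}" for i
      by (auto simp: space_restrict_space)
    then show ?thesis using int by (subst Bochner_Integration.integral_sum) simp_all
  qed
  also have "\<dots> = (\<Sum>i<N. h i / real N)" 
    by (intro sum.cong refl) (simp only: lessThan_iff measure_cell[OF N] times_divide_eq_right mult_1_right)
  finally show "(\<integral>x. h (cell N x) \<partial>unit_lebesgue) = (\<Sum>i<N. h i) / real N"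
    by (simp add: sum_divide_distrib)
qed

lemma integral_cell_upto:
  fixes h :: "nat \<Rightarrow> real"
  assumes N: "0 < N" and m: "m \<le> N"
  shows "(\<integral>x. h (cell N x) * indicator {0..real m / real N} x \<partial>unit_lebesgue) = (\<Sum>i<m. h i) / real N"
proof -
  have "(\<integral>x. h (cell N x) * indicator {0..real m / real N} x \<partial>unit_lebesgue)
      = (\<integral>x. (\<lambda>i. if i < m then h i else 0) (cell N x) \<partial>unit_lebesgue)"
  proof (rule integral_cong_AE)
    show "AE x in unit_lebesgue. h (cell N x) * indicator {0..real m / real N} x = (\<lambda>i. if i < m then h i else 0) (cell N x)"
      using AE_unit_lebesgue_neq[of 1] AE_unit_lebesgue_neq[of "real m / real N"] AE_space
    proof eventually_elim
      case (elim x)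
      let ?i = "cell N x"
      have x: "0 \<le> x" "x < 1" using elim by (auto simp: space_restrict_space)
      then have i: "real ?i / real N \<le> x" "x < (real ?i + 1) / real N"
        using cell_eq_iff[OF N, of x ?i] by auto
      have "x \<le> real m / real N \<longleftrightarrow> ?i < m"
      proof
        assume "x \<le> real m / real N"
        then have "real ?i / real N < real m / real N" using i elim by auto
        then show "?i < m" using N by (simp add: divide_less_cancel)
      next
        assume "?i < m"
        then have "real ?i + 1 \<le> real m" by linarith
        then have "(real ?i + 1) / real N \<le> real m / real N" by (rule divide_right_mono) simp
        then show "x \<le> real m / real N" using i by auto
      qed
      then show ?case using x by (simp add: indicator_def)
    qed
    show "(\<lambda>x. h (cell N x) * indicator {0..real m / real N} x) \<in> borel_measurable unit_lebesgue"
      by (intro borel_measurable_times measurable_cell_fun measurable_restrict_space1) measurable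
  qed (rule measurable_cell_fun)
  also have "\<dots> = (\<Sum>i<N. if i < m then h i else 0) / real N" by (rule integral_cell[OF N])
  also have "(\<Sum>i<N. if i < m then h i else 0) = (\<Sum>i\<in>{..<N} \<inter> {i. i < m}. h i)"
    by (simp add: sum.inter_restrict)
  also have "{..<N} \<inter> {i. i < m} = {..<m}" using m by auto
  finally show ?thesis .
qed

section \<open>Checkerboard approximations\<close>

lemma kernel_space:
  assumes "K \<in> unit_borel \<rightarrow>\<^sub>M prob_algebra unit_borel" "t \<in> {0..1}"
  shows "prob_space (K t)" "sets (K t) = sets unit_borel"
  using measurable_space[OF assms(1), of t] assms(2) by (auto simp: space_prob_algebra space_restrict_space)

lemma measurable_kernel_measure:
  assumes K: "K \<in> unit_borel \<rightarrow>\<^sub>M prob_algebra unit_borel" and A: "A \<in> sets unit_borel"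
  shows "(\<lambda>t. measure (K t) A) \<in> borel_measurable unit_lebesgue"
  using measurable_compose[OF K measurable_measure_prob_algebra[OF A]]
  by (simp add: measurable_cong_sets[OF sets_unit_lebesgue refl])

text \<open>Any measurable family of probability measures whose mixture is uniform is the kernel of a copula:
  the first margin is uniform because each member has mass one, the second one by assumption, and
  rectangles get nonnegative mass because they are integrals of nonnegative quantities.\<close>

lemma copula_kernel_copula:
  fixes K :: "real \<Rightarrow> real measure"
  defines "C \<equiv> \<lambda>s y. \<integral>t. measure (K t) {0..y} * indicator {0..s} t \<partial>unit_lebesgue"
  assumes K: "K \<in> unit_borel \<rightarrow>\<^sub>M prob_algebra unit_borel"
    and margin: "\<And>y. y \<in> {0..1} \<Longrightarrow> (\<integral>\<^sup>+ t. emeasure (K t) {0..y} \<partial>unit_lebesgue) = ennreal y"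
  shows "copula C" "markov_kernel C K"
proof -
  interpret prob_space unit_lebesgue by (rule prob_space_unit_lebesgue)
  let ?k = "\<lambda>y t. measure (K t) {0..y}"
  have sets: "{0..y} \<in> sets unit_borel" if "y \<in> {0..1}" for y
    using that by (simp add: sets_restrict_space_iff)
  have bound: "?k y t \<le> 1" if "t \<in> {0..1}" for y t
    using kernel_space(1)[OF K that] by (rule prob_space.prob_le_1)
  have em: "emeasure (K t) {0..y} = ennreal (?k y t)" if "t \<in> {0..1}" for y t
    using kernel_space(1)[OF K that] by (simp add: prob_space.finite_measure finite_measure.emeasure_eq_measure)
  have int: "integrable unit_lebesgue (?k y)" if "y \<in> {0..1}" for y
    using bound measurable_kernel_measure[OF K sets[OF that]]
    by (intro integrable_const_bound[of _ 1]) (auto simp: space_restrict_space)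
  have intI: "integrable unit_lebesgue (\<lambda>t. ?k y t * indicator {0..s} t)"
    if "y \<in> {0..1}" "s \<in> {0..1}" for y s
    using that by (intro integrable_real_mult_indicator int) (auto simp: sets_restrict_space_iff)
  have k1: "?k 1 t = 1" if "t \<in> {0..1}" for t
    using kernel_space[OF K that] sets_eq_imp_space_eq[OF kernel_space(2)[OF K that]]
    by (metis atLeastAtMost_borel prob_space.prob_space space_restrict_space2)
  have tot: "(\<integral>t. ?k y t \<partial>unit_lebesgue) = y" if "y \<in> {0..1}" for y
  proof -
    have "ennreal y = (\<integral>\<^sup>+ t. ennreal (?k y t) \<partial>unit_lebesgue)"
      unfolding margin[OF that, symmetric] by (intro nn_integral_cong em) (simp add: space_restrict_space)
    also have "\<dots> = ennreal (\<integral>t. ?k y t \<partial>unit_lebesgue)"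
      by (intro nn_integral_eq_integral int[OF that]) auto
    finally show ?thesis using that by (simp add: ennreal_inj integral_nonneg_AE)
  qed
  show "markov_kernel C K"
  proof (rule markov_kernelI[OF K])
    fix s y :: real assume s: "s \<in> {0..1}" and y: "y \<in> {0..1}"
    have "(\<integral>\<^sup>+ t\<in>{0..s}. emeasure (K t) {0..y} \<partial>unit_lebesgue)
        = (\<integral>\<^sup>+ t. ennreal (?k y t * indicator {0..s} t) \<partial>unit_lebesgue)"
      by (intro nn_integral_cong) (auto simp: em space_restrict_space indicator_def)
    also have "\<dots> = ennreal (C s y)"
      unfolding C_def by (intro nn_integral_eq_integral intI[OF y s]) auto
    finally show "(\<integral>\<^sup>+ t\<in>{0..s}. emeasure (K t) {0..y} \<partial>unit_lebesgue) = ennreal (C s y)" .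
  qed
  show "copula C" unfolding copula_def
  proof (intro conjI ballI allI impI)
    fix t :: real assume t: "t \<in> {0..1}"
    have "C t 0 \<le> (\<integral>u. ?k 0 u \<partial>unit_lebesgue)"
      unfolding C_def using t by (intro integral_mono intI int) (auto simp: indicator_def)
    moreover have "0 \<le> C t 0" unfolding C_def by (intro integral_nonneg_AE) auto
    ultimately show "C t 0 = 0" using tot[of 0] by simp
    show "C 0 t = 0"
      unfolding C_def
    proof (rule integral_eq_zero_AE)
      show "AE u in unit_lebesgue. ?k t u * indicator {0..0} u = 0"
        using AE_unit_lebesgue_neq[of 0] by eventually_elim auto
    qed
    have "C t 1 = (\<integral>u. indicator {0..t} u \<partial>unit_lebesgue)"
      unfolding C_def by (intro Bochner_Integration.integral_cong) (auto simp: k1 space_restrict_space)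
    also have "\<dots> = measure unit_lebesgue {0..t}"
      using t by (simp add: space_restrict_space Int_absorb2)
    also have "\<dots> = t" using t by (subst measure_restrict_space) auto
    finally show "C t 1 = t" .
    have "C 1 t = (\<integral>u. ?k t u \<partial>unit_lebesgue)"
      unfolding C_def by (intro Bochner_Integration.integral_cong) (auto simp: space_restrict_space)
    then show "C 1 t = t" using tot[OF t] by simp
  next
    fix x1 x2 y1 y2 :: real
    assume "0 \<le> x1 \<and> x1 \<le> x2 \<and> x2 \<le> 1 \<and> 0 \<le> y1 \<and> y1 \<le> y2 \<and> y2 \<le> 1"
    then have x: "x1 \<in> {0..1}" "x2 \<in> {0..1}" "x1 \<le> x2" and y: "y1 \<in> {0..1}" "y2 \<in> {0..1}" "y1 \<le> y2"
      by auto
    have "0 \<le> (\<integral>t. (?k y2 t - ?k y1 t) * (indicator {0..x2} t - indicator {0..x1} t) \<partial>unit_lebesgue)"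
    proof (rule Bochner_Integration.integral_nonneg)
      fix t assume "t \<in> space unit_lebesgue"
      then have t: "t \<in> {0..1}" by (simp add: space_restrict_space)
      have "?k y1 t \<le> ?k y2 t"
        using kernel_space[OF K t] y sets
        by (intro finite_measure.finite_measure_mono prob_space.finite_measure) auto
      then show "0 \<le> (?k y2 t - ?k y1 t) * (indicator {0..x2} t - indicator {0..x1} t)"
        using x by (auto simp: indicator_def)
    qed
    also have "\<dots> = C x2 y2 - C x1 y2 - C x2 y1 + C x1 y1"
    proof -
      have "(?k y2 t - ?k y1 t) * (indicator {0..x2} t - indicator {0..x1} t) =
          ?k y2 t * indicator {0..x2} t - ?k y2 t * indicator {0..x1} t
          - ?k y1 t * indicator {0..x2} t + ?k y1 t * indicator {0..x1} t" for t
        by (simp add: algebra_simps)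
      then show ?thesis unfolding C_def using x y by (simp add: intI)
    qed
    finally show "0 \<le> C x2 y2 - C x1 y2 - C x2 y1 + C x1 y1" .
  qed
qed

text \<open>The mass that \<open>C\<close> gives to a square of the grid, with indices counted from \<open>0\<close>.\<close>

definition cell_mass :: "(real \<Rightarrow> real \<Rightarrow> real) \<Rightarrow> nat \<Rightarrow> nat \<Rightarrow> nat \<Rightarrow> real" where
  "cell_mass C N i j =
    C ((real i + 1) / real N) ((real j + 1) / real N) - C (real i / real N) ((real j + 1) / real N)
    - C ((real i + 1) / real N) (real j / real N) + C (real i / real N) (real j / real N)"

lemma grid_point:
  assumes "i < N"
  shows "real i / real N \<in> {0..1}" "(real i + 1) / real N \<in> {0..1}" "real i / real N \<le> (real i + 1) / real N"
proof -
  have "real i + 1 \<le> real N" "0 < real N" using assms by linarith+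
  then show "real i / real N \<in> {0..1}" "(real i + 1) / real N \<in> {0..1}" "real i / real N \<le> (real i + 1) / real N"
    by (auto simp: divide_right_mono)
qed

lemma cell_mass_nonneg:
  assumes "copula C" "i < N" "j < N"
  shows "0 \<le> cell_mass C N i j"
  using assms(1) grid_point[OF assms(2)] grid_point[OF assms(3)]
  unfolding copula_def cell_mass_def by simp

lemma sum_cell_mass_column:
  assumes C: "copula C" and i: "i < N"
  shows "(\<Sum>j<m. cell_mass C N i j) = C ((real i + 1) / real N) (real m / real N) - C (real i / real N) (real m / real N)"
proof -
  let ?d = "\<lambda>j. C ((real i + 1) / real N) (real j / real N) - C (real i / real N) (real j / real N)"
  have "(\<Sum>j<m. cell_mass C N i j) = (\<Sum>j<m. ?d (Suc j) - ?d j)"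
    by (intro sum.cong) (auto simp: cell_mass_def add.commute)
  also have "\<dots> = ?d m - ?d 0" by (rule sum_lessThan_telescope)
  also have "?d 0 = 0" using C grid_point[OF i] by (simp add: copula_def)
  finally show ?thesis by simp
qed

lemma sum_cell_mass_row:
  assumes C: "copula C" and j: "j < N"
  shows "(\<Sum>i<N. cell_mass C N i j) = 1 / real N"
proof -
  let ?d = "\<lambda>i. C (real i / real N) ((real j + 1) / real N) - C (real i / real N) (real j / real N)"
  have "(\<Sum>i<N. cell_mass C N i j) = (\<Sum>i<N. ?d (Suc i) - ?d i)"
    by (intro sum.cong) (auto simp: cell_mass_def add.commute)
  also have "\<dots> = ?d N - ?d 0" by (rule sum_lessThan_telescope)
  also have "\<dots> = 1 / real N"
    using C grid_point[OF j] j by (simp add: copula_def diff_divide_distrib[symmetric])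
  finally show ?thesis .
qed

text \<open>A square of side \<open>1 / N\<close> carries its mass with density \<open>N\<^sup>2\<close> times that mass.\<close>

definition checkerboard_kernel :: "(real \<Rightarrow> real \<Rightarrow> real) \<Rightarrow> nat \<Rightarrow> real \<Rightarrow> real measure" where
  "checkerboard_kernel C N x =
    density unit_lebesgue (\<lambda>y. ennreal ((real N)\<^sup>2 * cell_mass C N (cell N x) (cell N y)))"

definition checkerboard :: "(real \<Rightarrow> real \<Rightarrow> real) \<Rightarrow> nat \<Rightarrow> real \<Rightarrow> real \<Rightarrow> real" where
  "checkerboard C N s y =
    (\<integral>t. measure (checkerboard_kernel C N t) {0..y} * indicator {0..s} t \<partial>unit_lebesgue)"

definition slope :: "(real \<Rightarrow> real \<Rightarrow> real) \<Rightarrow> nat \<Rightarrow> real \<Rightarrow> real \<Rightarrow> real" where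
  "slope C N x y = real N * (C ((real (cell N x) + 1) / real N) y - C (real (cell N x) / real N) y)"

text \<open>On grid heights no interpolation is visible: summing the masses of a column of squares telescopes to
  a difference quotient of \<open>C\<close> itself.\<close>

lemma emeasure_checkerboard_kernel_grid:
  assumes C: "copula C" and N: "0 < N" and m: "m \<le> N"
  shows "emeasure (checkerboard_kernel C N x) {0..real m / real N} = ennreal (slope C N x (real m / real N))"
proof -
  let ?h = "\<lambda>j. (real N)\<^sup>2 * cell_mass C N (cell N x) j"
  have "real m / real N \<le> 1" using N m by simp
  then have sets: "{0..real m / real N} \<in> sets unit_lebesgue" by (simp add: sets_restrict_space_iff)
  have "emeasure (checkerboard_kernel C N x) {0..real m / real N}
      = (\<integral>\<^sup>+ y. ennreal (?h (cell N y)) * indicator {0..real m / real N} y \<partial>unit_lebesgue)"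
    unfolding checkerboard_kernel_def
    by (intro emeasure_density measurable_compose[OF measurable_cell_fun measurable_ennreal] sets)
  also have "\<dots> = (\<integral>\<^sup>+ y. ennreal (?h (cell N y) * indicator {0..real m / real N} y) \<partial>unit_lebesgue)"
    by (intro nn_integral_cong) (auto simp: indicator_def)
  also have "\<dots> = ennreal (\<integral>y. ?h (cell N y) * indicator {0..real m / real N} y \<partial>unit_lebesgue)"
    using cell_mass_nonneg[OF C cell_less[OF N] cell_less[OF N]]
    by (intro nn_integral_eq_integral integrable_real_mult_indicator sets integrable_cell[OF N, of ?h]) auto
  also have "(\<integral>y. ?h (cell N y) * indicator {0..real m / real N} y \<partial>unit_lebesgue) = (\<Sum>j<m. ?h j) / real N"
    by (rule integral_cell_upto[OF N m])
  also have "\<dots> = slope C N x (real m / real N)"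
    using N by (simp add: sum_distrib_left[symmetric] sum_cell_mass_column[OF C cell_less[OF N]] slope_def power2_eq_square)
  finally show ?thesis .
qed

lemma slope_1:
  assumes "copula C" "0 < N"
  shows "slope C N x 1 = 1"
  using assms grid_point[OF cell_less[OF assms(2)], of x]
  by (simp add: slope_def copula_def diff_divide_distrib[symmetric])

text \<open>The kernel depends on \<open>x\<close> only through its cell, so measurability reduces to a map on a finite
  set; the total mass is the slope at height \<open>1\<close>.\<close>

lemma checkerboard_kernel_measurable:
  assumes C: "copula C" and N: "0 < N"
  shows "checkerboard_kernel C N \<in> unit_borel \<rightarrow>\<^sub>M prob_algebra unit_borel"
proof -
  let ?k = "\<lambda>i. density unit_lebesgue (\<lambda>y. ennreal ((real N)\<^sup>2 * cell_mass C N i (cell N y)))"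
  have k: "?k i \<in> space (prob_algebra unit_borel)" if i: "i < N" for i
  proof -
    have "real i / real N \<in> {0..1}" "real i / real N < 1" using i grid_point[OF i] by auto
    then have "cell N (real i / real N) = i"
      using cell_eq_iff[of N "real i / real N" i] i by (auto simp: divide_strict_right_mono)
    \<comment> \<open>the left end point of a cell lies in it, which makes every column density a value of the kernel\<close>
    then have "?k i = checkerboard_kernel C N (real i / real N)" by (simp add: checkerboard_kernel_def)
    moreover have "emeasure (checkerboard_kernel C N (real i / real N)) {0..1} = 1"
      using emeasure_checkerboard_kernel_grid[OF C N order_refl] slope_1[OF C N] N by simp
    moreover have "space (?k i) = {0..1}" by (simp add: space_restrict_space)
    ultimately have "emeasure (?k i) (space (?k i)) = 1" by simp
    then show ?thesis
      by (auto simp: space_prob_algebra sets_unit_lebesgue intro!: prob_spaceI)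
  qed
  have "(\<lambda>x. ?k (cell N x)) \<in> unit_borel \<rightarrow>\<^sub>M prob_algebra unit_borel"
  proof (rule measurable_compose[where f="cell N" and g="?k" and N="count_space {..<N}"])
    show "cell N \<in> unit_borel \<rightarrow>\<^sub>M count_space {..<N}"
      using cell_less[OF N] measurable_restrict_space2[of "cell N" unit_borel "{..<N}" "count_space UNIV"]
        measurable_restrict_space1[OF measurable_cell, of N "{0..1}"]
      by (auto simp: restrict_count_space)
    show "?k \<in> count_space {..<N} \<rightarrow>\<^sub>M prob_algebra unit_borel" using k by auto
  qed
  then show ?thesis by (simp add: checkerboard_kernel_def[abs_def])
qed

lemma measurable_cell_pair:
  fixes h :: "nat \<Rightarrow> nat \<Rightarrow> ennreal"
  shows "(\<lambda>(x, y). h (cell N x) (cell N y)) \<in> borel_measurable (unit_lebesgue \<Otimes>\<^sub>M unit_lebesgue)"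
proof -
  have cell: "cell N \<in> unit_lebesgue \<rightarrow>\<^sub>M count_space UNIV"
    by (intro measurable_restrict_space1) measurable
  have "(\<lambda>p. h (cell N (fst p)) (cell N (snd p))) \<in> borel_measurable (unit_lebesgue \<Otimes>\<^sub>M unit_lebesgue)"
  proof (rule measurable_compose_countable'[where f="\<lambda>i p. h i (cell N (snd p))" and I=UNIV])
    fix i show "(\<lambda>p. h i (cell N (snd p))) \<in> borel_measurable (unit_lebesgue \<Otimes>\<^sub>M unit_lebesgue)"
      by (rule measurable_compose[OF measurable_compose[OF measurable_snd cell], of "h i"]) simp
    show "(\<lambda>p. cell N (fst p)) \<in> unit_lebesgue \<Otimes>\<^sub>M unit_lebesgue \<rightarrow>\<^sub>M count_space UNIV"
      by (rule measurable_compose[OF measurable_fst cell])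
  qed auto
  then show ?thesis by (simp add: case_prod_beta')
qed

text \<open>By Fubini the mixture of the kernel has as its density the average of the densities over \<open>x\<close>, which
  equals \<open>1\<close> because each horizontal row of squares has total mass \<open>1 / N\<close>.\<close>

lemma checkerboard_kernel_margin:
  assumes C: "copula C" and N: "0 < N" and y: "y \<in> {0..1}"
  shows "(\<integral>\<^sup>+ t. emeasure (checkerboard_kernel C N t) {0..y} \<partial>unit_lebesgue) = ennreal y"
proof -
  interpret U: prob_space unit_lebesgue by (rule prob_space_unit_lebesgue)
  interpret pair_sigma_finite unit_lebesgue unit_lebesgue ..
  let ?h = "\<lambda>i j. (real N)\<^sup>2 * cell_mass C N i j"
  have sets: "{0..y} \<in> sets unit_lebesgue" using y by (simp add: sets_restrict_space_iff)
  have "(\<integral>\<^sup>+ t. emeasure (checkerboard_kernel C N t) {0..y} \<partial>unit_lebesgue)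
      = (\<integral>\<^sup>+ t. \<integral>\<^sup>+ u. ennreal (?h (cell N t) (cell N u)) * indicator {0..y} u \<partial>unit_lebesgue \<partial>unit_lebesgue)"
    unfolding checkerboard_kernel_def
    by (intro nn_integral_cong emeasure_density measurable_compose[OF measurable_cell_fun measurable_ennreal] sets)
  also have "\<dots> = (\<integral>\<^sup>+ u. \<integral>\<^sup>+ t. ennreal (?h (cell N t) (cell N u)) * indicator {0..y} u \<partial>unit_lebesgue \<partial>unit_lebesgue)"
  proof (rule Fubini'[symmetric])
    have "(\<lambda>p. (\<lambda>(t, u). ennreal (?h (cell N t) (cell N u))) p * indicator {0..y} (snd p))
        \<in> borel_measurable (unit_lebesgue \<Otimes>\<^sub>M unit_lebesgue)"
      using sets by (intro borel_measurable_times_ennreal measurable_cell_pair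
          measurable_compose[OF measurable_snd] borel_measurable_indicator)
    then show "(\<lambda>(t, u). ennreal (?h (cell N t) (cell N u)) * indicator {0..y} u)
        \<in> borel_measurable (unit_lebesgue \<Otimes>\<^sub>M unit_lebesgue)"
      unfolding case_prod_beta .
  qed
  also have "\<dots> = (\<integral>\<^sup>+ u. indicator {0..y} u \<partial>unit_lebesgue)"
  proof (rule nn_integral_cong)
    fix u :: real
    let ?j = "cell N u"
    have "(\<integral>\<^sup>+ t. ennreal (?h (cell N t) ?j) \<partial>unit_lebesgue) = ennreal (\<integral>t. ?h (cell N t) ?j \<partial>unit_lebesgue)"
      using cell_mass_nonneg[OF C cell_less[OF N] cell_less[OF N]]
      by (intro nn_integral_eq_integral integrable_cell[OF N, of "\<lambda>i. ?h i ?j"]) auto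
    also have "(\<integral>t. ?h (cell N t) ?j \<partial>unit_lebesgue) = (\<Sum>i<N. ?h i ?j) / real N"
      by (rule integral_cell[OF N])
    also have "\<dots> = 1"
      using N by (simp add: sum_distrib_left[symmetric] sum_cell_mass_row[OF C cell_less[OF N]] power2_eq_square)
    finally show "(\<integral>\<^sup>+ t. ennreal (?h (cell N t) ?j) * indicator {0..y} u \<partial>unit_lebesgue) = indicator {0..y} u"
      using nn_integral_multc[OF measurable_compose[OF measurable_cell_fun[of "\<lambda>i. ?h i ?j"] measurable_ennreal]]
      by simp
  qed
  also have "\<dots> = emeasure lborel {0..y}"
    using sets y by (simp add: emeasure_restrict_space)
  also have "\<dots> = ennreal y" using y by simp
  finally show ?thesis .
qed

lemma
  assumes "copula C" "0 < N"
  shows copula_checkerboard: "copula (checkerboard C N)"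
    and markov_kernel_checkerboard: "markov_kernel (checkerboard C N) (checkerboard_kernel C N)"
  using copula_kernel_copula[OF checkerboard_kernel_measurable[OF assms] checkerboard_kernel_margin[OF assms]]
  unfolding checkerboard_def[abs_def] by auto

text \<open>The density is constant on a square up to its upper and right edges, where \<^const>\<open>cell\<close> already
  belongs to the neighbouring square; these edges are null sets. The square with zero-based
  indices \<open>i\<close> and \<open>j\<close> is \<open>grid_square N (Suc i) (Suc j)\<close>.\<close>

lemma checkerboard_measure_cell:
  assumes C: "copula C" and N: "0 < N" and i: "i < N" and j: "j < N"
    and A: "A \<in> sets borel" "A \<subseteq> grid_square N (Suc i) (Suc j)"
  shows "emeasure (copula_measure (checkerboard C N)) A = ennreal ((real N)\<^sup>2 * cell_mass C N i j) * emeasure lborel A"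
proof -
  let ?I = "{real i / real N..(real i + 1) / real N}" and ?J = "{real j / real N..(real j + 1) / real N}"
  let ?c = "ennreal ((real N)\<^sup>2 * cell_mass C N i j)"
  have A_prod: "A \<in> sets (lborel \<Otimes>\<^sub>M lborel)" using A(1) unfolding lborel_prod by simp
  have AIJ: "A \<subseteq> ?I \<times> ?J" using A(2) by (simp add: grid_square_def add.commute)
  have I01: "?I \<subseteq> {0..1}" "?J \<subseteq> {0..1}" using grid_point[OF i] grid_point[OF j] by auto
  with AIJ have A01: "A \<subseteq> {0..1} \<times> {0..1}" by blast
  then have "A \<in> sets unit_square_borel"
    using A(1) by (simp add: sets_restrict_space_iff borel_closed closed_Times)
  then have "emeasure (copula_measure (checkerboard C N)) A
      = (\<integral>\<^sup>+ x. emeasure (checkerboard_kernel C N x) {y. (x, y) \<in> A} \<partial>unit_lebesgue)"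
    using markov_kernel_checkerboard[OF C N] by (simp add: markov_kernel_def)
  also have "\<dots> = (\<integral>\<^sup>+ x. ?c * emeasure lborel (Pair x -` A) \<partial>unit_lebesgue)"
  proof (rule nn_integral_cong_AE)
    show "AE x in unit_lebesgue. emeasure (checkerboard_kernel C N x) {y. (x, y) \<in> A} = ?c * emeasure lborel (Pair x -` A)"
      using AE_unit_lebesgue_neq[of "(real i + 1) / real N"] AE_space
    proof eventually_elim
      case (elim x)
      let ?A = "Pair x -` A"
      have A_sets: "?A \<in> sets borel" using A(1) by (metis borel_prod sets_Pair1)
      have A_unit: "?A \<in> sets unit_lebesgue"
        using A_sets A01 by (auto simp: sets_restrict_space_iff)
      have cell_x: "cell N x = i" if "?A \<noteq> {}"
      proof -
        have "x \<in> ?I" using that AIJ by auto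
        then have "real i / real N \<le> x" "x < (real i + 1) / real N" using elim by auto
        moreover have "0 \<le> x" using order_trans[OF _ calculation(1)] by simp
        ultimately show ?thesis using cell_eq_iff[OF N, of x i] grid_point(2)[OF i] by simp
      qed
      have "emeasure (checkerboard_kernel C N x) {y. (x, y) \<in> A} = emeasure (checkerboard_kernel C N x) ?A"
        by (simp add: vimage_def)
      also have "\<dots> = (\<integral>\<^sup>+ y. ennreal ((real N)\<^sup>2 * cell_mass C N (cell N x) (cell N y)) * indicator ?A y \<partial>unit_lebesgue)"
        unfolding checkerboard_kernel_def
        by (intro emeasure_density measurable_compose[OF measurable_cell_fun measurable_ennreal] A_unit)
      also have "\<dots> = (\<integral>\<^sup>+ y. ?c * indicator ?A y \<partial>unit_lebesgue)"
      proof (rule nn_integral_cong_AE)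
        show "AE y in unit_lebesgue. ennreal ((real N)\<^sup>2 * cell_mass C N (cell N x) (cell N y)) * indicator ?A y = ?c * indicator ?A y"
          using AE_unit_lebesgue_neq[of "(real j + 1) / real N"]
        proof eventually_elim
          case (elim y)
          show ?case
          proof (cases "y \<in> ?A")
            case True
            then have "y \<in> ?J" using AIJ by auto
            then have "real j / real N \<le> y" "y < (real j + 1) / real N" using elim by auto
            moreover have "0 \<le> y" using order_trans[OF _ calculation(1)] by simp
            ultimately have "cell N y = j" using cell_eq_iff[OF N, of y j] grid_point(2)[OF j] by simp
            then show ?thesis using cell_x True by auto
          qed simp
        qed
      qed
      also have "\<dots> = ?c * emeasure unit_lebesgue ?A"
        using A_unit by (rule nn_integral_cmult_indicator)
      also have "emeasure unit_lebesgue ?A = emeasure lborel ?A"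
        using A01 by (intro emeasure_restrict_space) auto
      finally show ?case .
    qed
  qed
  also have "\<dots> = (\<integral>\<^sup>+ x. ?c * emeasure lborel (Pair x -` A) \<partial>lborel)"
  proof -
    have "?c * emeasure lborel (Pair x -` A) * indicator {0..1} x = ?c * emeasure lborel (Pair x -` A)" for x
    proof (cases "x \<in> {0..1}")
      case False
      then have "Pair x -` A = {}" using A01 by auto
      then show ?thesis by simp
    qed simp
    then show ?thesis by (subst nn_integral_restrict_space) auto
  qed
  also have "\<dots> = ?c * (\<integral>\<^sup>+ x. emeasure lborel (Pair x -` A) \<partial>lborel)"
    by (intro nn_integral_cmult lborel.measurable_emeasure_Pair A_prod)
  also have "(\<integral>\<^sup>+ x. emeasure lborel (Pair x -` A) \<partial>lborel) = emeasure (lborel \<Otimes>\<^sub>M lborel) A"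
    by (intro lborel.emeasure_pair_measure_alt[symmetric] A_prod)
  finally show ?thesis by (simp add: lborel_prod)
qed

lemma checkerboard_in_checkerboard_copulas:
  assumes C: "copula C" and N: "0 < N"
  shows "checkerboard C N \<in> checkerboard_copulas"
proof -
  let ?\<mu> = "copula_measure (checkerboard C N)"
  have "emeasure ?\<mu> A = emeasure ?\<mu> (grid_square N i j) * emeasure (uniform_measure lborel (grid_square N i j)) A"
    if i: "i \<in> {1..N}" and j: "j \<in> {1..N}" and A: "A \<in> sets borel" "A \<subseteq> grid_square N i j" for i j A
  proof -
    obtain i' where i': "i = Suc i'" "i' < N" using i by (cases i) auto
    obtain j' where j': "j = Suc j'" "j' < N" using j by (cases j) auto
    let ?R = "grid_square N i j"
    have sets: "?R \<in> sets borel" by (simp add: grid_square_def borel_closed closed_Times)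
    have "emeasure lborel ?R = ennreal (1 / real N * (1 / real N))"
    proof -
      have "emeasure lborel ?R = emeasure lborel {(real i - 1) / real N .. real i / real N}
          * emeasure lborel {(real j - 1) / real N .. real j / real N}"
        unfolding grid_square_def lborel_prod[symmetric] by (intro lborel.emeasure_pair_measure_Times) auto
      also have "\<dots> = ennreal (1 / real N * (1 / real N))"
        by (simp add: divide_right_mono diff_divide_distrib[symmetric] ennreal_mult[symmetric])
      finally show ?thesis .
    qed
    moreover have "ennreal (1 / real N * (1 / real N)) \<noteq> 0" using N by simp
    ultimately have R: "emeasure lborel ?R \<noteq> 0" "emeasure lborel ?R \<noteq> top" by (simp_all only: ennreal_neq_top not_False_eq_True)
    have "emeasure (uniform_measure lborel ?R) A = emeasure lborel A / emeasure lborel ?R"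
      using A sets by (subst emeasure_uniform_measure) (auto simp: Int_absorb1)
    then have "emeasure lborel ?R * emeasure (uniform_measure lborel ?R) A = emeasure lborel A"
      using ennreal_mult_divide_eq[OF R, of "emeasure lborel A"]
      by (simp only: ennreal_times_divide mult.commute[of "emeasure lborel ?R" "emeasure lborel A"])
    then show ?thesis
      using checkerboard_measure_cell[OF C N i'(2) j'(2), of A]
        checkerboard_measure_cell[OF C N i'(2) j'(2), of ?R] A i'(1) j'(1) sets
      by (simp add: mult.assoc)
  qed
  then have "checkerboard C N \<in> checkerboard_copulas_res N"
    using copula_checkerboard[OF C N] by (simp add: checkerboard_copulas_res_def)
  then show ?thesis using N by (auto simp: checkerboard_copulas_def Suc_le_eq)
qed

section \<open>Almost sure convergence of the difference quotients\<close>

lemma slope_mono: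
  assumes C: "copula C" and N: "0 < N" and y: "0 \<le> y1" "y1 \<le> y2" "y2 \<le> 1"
  shows "slope C N x y1 \<le> slope C N x y2"
proof -
  let ?i = "cell N x"
  have "0 \<le> C ((real ?i + 1) / real N) y2 - C (real ?i / real N) y2
      - C ((real ?i + 1) / real N) y1 + C (real ?i / real N) y1"
    using C y grid_point[OF cell_less[OF N], of x] unfolding copula_def by auto
  then show ?thesis
    unfolding slope_def by (intro mult_left_mono) auto
qed

lemma slope_0:
  assumes "copula C" "0 < N"
  shows "slope C N x 0 = 0"
  using assms grid_point[OF cell_less[OF assms(2)], of x]
  by (simp add: slope_def copula_def)

lemma slope_bounds:
  assumes "copula C" "0 < N" "y \<in> {0..1}"
  shows "slope C N x y \<in> {0..1}"
  using slope_mono[OF assms(1,2), of 0 y x] slope_mono[OF assms(1,2), of y 1 x] assms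
  by (simp add: slope_0 slope_1)

lemma measurable_slope [measurable]: "(\<lambda>x. slope C N x y) \<in> borel_measurable unit_lebesgue"
  unfolding slope_def
  by (rule measurable_cell_fun[of "\<lambda>i. real N * (C ((real i + 1) / real N) y - C (real i / real N) y)"])

lemma integral_slope_upto:
  assumes C: "copula C" and N: "0 < N" and m: "m \<le> N" and y: "y \<in> {0..1}"
  shows "(\<integral>t. slope C N t y * indicator {0..real m / real N} t \<partial>unit_lebesgue) = C (real m / real N) y"
proof -
  let ?g = "\<lambda>i. C (real i / real N) y"
  have "(\<integral>t. slope C N t y * indicator {0..real m / real N} t \<partial>unit_lebesgue)
      = (\<Sum>i<m. real N * (?g (Suc i) - ?g i)) / real N"
    unfolding slope_def
    using integral_cell_upto[OF N m, of "\<lambda>i. real N * (C ((real i + 1) / real N) y - C (real i / real N) y)"]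
    by (simp add: add.commute)
  also have "\<dots> = (\<Sum>i<m. ?g (Suc i) - ?g i)"
    using N by (simp only: sum_distrib_left[symmetric]) simp
  also have "\<dots> = ?g m - ?g 0" by (rule sum_lessThan_telescope)
  finally show ?thesis using C y by (simp add: copula_def)
qed

text \<open>The martingale property in integrated form: on a cell of the coarse grid the coarse slope is
  constant, and the fine slopes average to it. Against a coarse slope the fine one can therefore be
  replaced by the coarse one under the integral.\<close>

lemma integral_slope_mult_refine:
  assumes N: "0 < N" and k: "0 < k"
  shows "(\<integral>x. slope C (N * k) x y * slope C N x y \<partial>unit_lebesgue) = (\<integral>x. (slope C N x y)\<^sup>2 \<partial>unit_lebesgue)"
proof -
  define d where "d M i = real M * (C ((real i + 1) / real M) y - C (real i / real M) y)" for M i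
  have slope: "slope C M x y = d M (cell M x)" for M x by (simp add: slope_def d_def)
  have "(\<integral>x. slope C (N * k) x y * slope C N x y \<partial>unit_lebesgue)
      = (\<integral>x. (\<lambda>i. d (N * k) i * d N (i div k)) (cell (N * k) x) \<partial>unit_lebesgue)"
  proof (rule integral_cong_AE)
    show "AE x in unit_lebesgue. slope C (N * k) x y * slope C N x y
        = (\<lambda>i. d (N * k) i * d N (i div k)) (cell (N * k) x)"
      using AE_unit_lebesgue_neq[of 1] AE_space
    proof eventually_elim
      case (elim x)
      then show ?case using cell_div[OF N k, of x] by (simp add: slope space_restrict_space)
    qed
  qed (intro borel_measurable_times measurable_slope, rule measurable_cell_fun)
  also have "\<dots> = (\<Sum>i<N * k. d (N * k) i * d N (i div k)) / real (N * k)"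
    using N k by (intro integral_cell) simp
  also have "(\<Sum>i<N * k. d (N * k) i * d N (i div k))
      = (\<Sum>m<N. \<Sum>i\<in>{m * k..<m * k + k}. d (N * k) i * d N (i div k))"
    by (rule sum.nat_group[symmetric])
  also have "\<dots> = (\<Sum>m<N. real k * (d N m)\<^sup>2)"
  proof (rule sum.cong[OF refl])
    fix m
    let ?g = "\<lambda>i. C (real i / real (N * k)) y"
    have div: "i div k = m" if "i \<in> {m * k..<m * k + k}" for i
      using that k by (intro div_nat_eqI) (auto simp: algebra_simps)
    have grid: "real (l * k) / real (N * k) = real l / real N" for l using k by simp
    have "(\<Sum>i\<in>{m * k..<m * k + k}. d (N * k) i * d N (i div k))
        = (\<Sum>i\<in>{m * k..<m * k + k}. real (N * k) * d N m * (?g (Suc i) - ?g i))"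
      by (intro sum.cong) (auto simp: div d_def add.commute)
    also have "\<dots> = real (N * k) * d N m * (?g ((m + 1) * k) - ?g (m * k))"
      unfolding sum_distrib_left[symmetric] by (subst sum_Suc_diff') (auto simp: algebra_simps)
    also have "\<dots> = real k * (d N m)\<^sup>2"
      unfolding grid by (simp add: d_def power2_eq_square add.commute)
    finally show "(\<Sum>i\<in>{m * k..<m * k + k}. d (N * k) i * d N (i div k)) = real k * (d N m)\<^sup>2" .
  qed
  also have "\<dots> / real (N * k) = (\<Sum>m<N. (d N m)\<^sup>2) / real N"
    using k by (simp add: sum_distrib_left[symmetric])
  also have "\<dots> = (\<integral>x. (\<lambda>i. (d N i)\<^sup>2) (cell N x) \<partial>unit_lebesgue)"
    by (rule integral_cell[OF N, symmetric])
  finally show ?thesis by (simp add: slope)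
qed

text \<open>The assumption \<open>proj\<close> gives the Pythagorean identity: the squared distance of two members is the
  difference of their second moments. These are increasing and bounded, so the sequence is Cauchy
  in the quadratic mean, and hence in the mean.\<close>

lemma (in prob_space) bounded_orthogonal_increments_L1_Cauchy:
  fixes u :: "nat \<Rightarrow> 'a \<Rightarrow> real"
  assumes meas [measurable]: "\<And>n. u n \<in> borel_measurable M"
    and bound: "\<And>n x. x \<in> space M \<Longrightarrow> \<bar>u n x\<bar> \<le> B"
    and proj: "\<And>n m. n \<le> m \<Longrightarrow> (\<integral>x. u m x * u n x \<partial>M) = (\<integral>x. (u n x)\<^sup>2 \<partial>M)"
    and e: "0 < e"
  shows "\<exists>N. \<forall>i\<ge>N. \<forall>j\<ge>N. (\<integral>x. norm (u i x - u j x) \<partial>M) < e"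
proof -
  define a where "a n = (\<integral>x. (u n x)\<^sup>2 \<partial>M)" for n
  have bound2: "\<bar>u n x * u m x\<bar> \<le> B\<^sup>2" if "x \<in> space M" for n m x
    using mult_mono[OF bound[OF that, of n] bound[OF that, of m]] bound[OF that, of n]
    by (simp add: abs_mult power2_eq_square)
  have int: "integrable M (\<lambda>x. u n x * u m x)" for n m
    using bound2 by (intro integrable_const_bound[of _ "B\<^sup>2"]) auto
  have int1: "integrable M (u n)" for n
    using bound by (intro integrable_const_bound[of _ B]) auto
  have sq: "(u n x - u m x)\<^sup>2 = u n x * u n x - 2 * (u n x * u m x) + u m x * u m x" for n m x
    by (simp add: power2_eq_square algebra_simps)
  have int_sq: "integrable M (\<lambda>x. (u n x - u m x)\<^sup>2)" for n m
    unfolding sq by (intro Bochner_Integration.integrable_add Bochner_Integration.integrable_diff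
        integrable_mult_right int)
  have dist: "(\<integral>x. (u m x - u n x)\<^sup>2 \<partial>M) = a m - a n" if "n \<le> m" for n m
    using proj[OF that] unfolding sq a_def by (simp add: int power2_eq_square)
  have inc: "incseq a"
  proof (rule incseq_SucI)
    fix n
    have "0 \<le> (\<integral>x. (u (Suc n) x - u n x)\<^sup>2 \<partial>M)" by simp
    then show "a n \<le> a (Suc n)" using dist[of n "Suc n"] by simp
  qed
  have "a n \<le> B\<^sup>2" for n
  proof -
    have "a n \<le> (\<integral>x. B\<^sup>2 \<partial>M)"
      unfolding a_def power2_eq_square using bound2[of _ n n] int
      by (intro integral_mono) (auto simp: power2_eq_square abs_le_iff)
    then show ?thesis by (simp add: prob_space)
  qed
  with inc have "convergent a" by (metis incseq_convergent convergentI)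
  then have "Cauchy a" by (rule convergent_Cauchy)
  then obtain N where N: "\<And>i j. i \<ge> N \<Longrightarrow> j \<ge> N \<Longrightarrow> \<bar>a i - a j\<bar> < e\<^sup>2"
    using e unfolding Cauchy_def dist_real_def by (metis zero_less_power)
  have "(\<integral>x. norm (u i x - u j x) \<partial>M) < e" if ij: "i \<ge> N" "j \<ge> N" for i j
  proof -
    have sym: "(\<integral>x. (u i x - u j x)\<^sup>2 \<partial>M) = \<bar>a i - a j\<bar>"
    proof (cases "j \<le> i")
      case True
      then show ?thesis using dist[OF True] incseqD[OF inc True] by simp
    next
      case False
      then show ?thesis using dist[of i j] incseqD[OF inc, of i j] by (simp add: power2_commute)
    qed
    \<comment> \<open>the inequality between the means replaces the Cauchy-Schwarz inequality\<close>
    have amgm: "norm (u i x - u j x) \<le> ((u i x - u j x)\<^sup>2 / e + e) / 2" for x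
    proof -
      have "0 \<le> (\<bar>u i x - u j x\<bar> - e)\<^sup>2" by simp
      then have "2 * \<bar>u i x - u j x\<bar> * e \<le> (u i x - u j x)\<^sup>2 + e * e"
        by (simp add: power2_diff power2_eq_square[of e])
      then show ?thesis using e by (simp add: field_simps)
    qed
    have "(\<integral>x. norm (u i x - u j x) \<partial>M) \<le> (\<integral>x. ((u i x - u j x)\<^sup>2 / e + e) / 2 \<partial>M)"
      by (intro integral_mono amgm integrable_norm Bochner_Integration.integrable_diff int1
          integrable_divide Bochner_Integration.integrable_add int_sq integrable_const)
    also have "\<dots> = (\<bar>a i - a j\<bar> / e + e) / 2"
      using int_sq by (simp add: sym prob_space)
    also have "\<dots> < (e\<^sup>2 / e + e) / 2"
      using N[OF ij] e by (simp add: divide_strict_right_mono)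
    also have "\<dots> = e" using e by (simp add: power2_eq_square)
    finally show ?thesis .
  qed
  then show ?thesis by blast
qed

text \<open>Cauchy sequences in the mean have almost surely convergent subsequences; the diagonal sequence is,
  up to finitely many terms, a subsequence of the one chosen for each index \<open>j\<close>.\<close>

lemma AE_convergent_common_subseq:
  fixes u :: "nat \<Rightarrow> nat \<Rightarrow> 'a \<Rightarrow> real"
  assumes int: "\<And>j n. integrable M (u j n)"
    and cauchy: "\<And>j e. 0 < e \<Longrightarrow> \<exists>N. \<forall>m\<ge>N. \<forall>n\<ge>N. (\<integral>x. norm (u j m x - u j n x) \<partial>M) < e"
  obtains r :: "nat \<Rightarrow> nat" where "strict_mono r" "\<And>j. AE x in M. convergent (\<lambda>k. u j (r k) x)"
proof -
  interpret subseqs "\<lambda>j r. AE x in M. convergent (\<lambda>k. u j (r k) x)"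
  proof
    fix j and s :: "nat \<Rightarrow> nat" assume s: "strict_mono s"
    have "\<exists>N. \<forall>m\<ge>N. \<forall>n\<ge>N. (\<integral>x. norm (u j (s m) x - u j (s n) x) \<partial>M) < e" if "0 < e" for e
      using cauchy[OF that, of j] seq_suble[OF s] by (meson order_trans)
    then obtain r where "strict_mono r" "AE x in M. Cauchy (\<lambda>i. u j (s (r i)) x)"
      using cauchy_L1_AE_cauchy_subseq[of M "\<lambda>n. u j (s n)"] int by blast
    then show "\<exists>r'. strict_mono r' \<and> (AE x in M. convergent (\<lambda>k. u j ((s \<circ> r') k) x))"
      by (auto simp: Cauchy_convergent_iff)
  qed
  have "AE x in M. convergent (\<lambda>k. u j (diagseq k) x)" for j
  proof -
    have "AE x in M. convergent (\<lambda>k. u j ((diagseq \<circ> (+) (Suc j)) k) x)"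
    proof (rule diagseq_holds)
      fix r s :: "nat \<Rightarrow> nat" and n assume r: "strict_mono r"
        and "AE x in M. convergent (\<lambda>k. u n (s k) x)"
      from this(2) show "AE x in M. convergent (\<lambda>k. u n ((s \<circ> r) k) x)"
        by eventually_elim (use convergent_subseq_convergent[OF _ r] in \<open>auto simp: o_def\<close>)
    qed
    then show ?thesis
    proof eventually_elim
      case (elim x)
      then have "convergent (\<lambda>k. u j (diagseq (k + Suc j)) x)" by (simp add: o_def add.commute)
      then show ?case
        using convergent_ignore_initial_segment[of "\<lambda>k. u j (diagseq k) x" "Suc j"] by simp
    qed
  qed
  with subseq_diagseq that show ?thesis by blast
qed

section \<open>Distribution functions prescribed at the rationals\<close>

text \<open>The limit \<open>\<phi>\<close> along the rationals need not agree with \<open>G\<close> where \<open>G\<close> jumps, but at each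
  rational it lies between the values of \<open>G\<close> to the left and the value of \<open>G\<close> at that point. Near a
  continuity point of \<open>G\<close> this suffices, by monotonicity of the functions \<open>F n\<close>.\<close>

lemma weak_conv_rational:
  fixes F :: "nat \<Rightarrow> real \<Rightarrow> real" and G \<phi> :: "real \<Rightarrow> real"
  assumes mono: "\<And>n. mono (F n)"
    and conv: "\<And>q. q \<in> \<rat> \<Longrightarrow> (\<lambda>n. F n q) \<longlonglongrightarrow> \<phi> q"
    and below: "\<And>q y. q \<in> \<rat> \<Longrightarrow> q \<le> y \<Longrightarrow> \<phi> q \<le> G y"
    and above: "\<And>q y. q \<in> \<rat> \<Longrightarrow> y < q \<Longrightarrow> G y \<le> \<phi> q"
  shows "weak_conv F G"
  unfolding weak_conv_def
proof (intro allI impI)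
  fix y assume "isCont G y"
  then have G: "(G \<longlongrightarrow> G y) (at y)" by (simp add: isCont_def)
  show "(\<lambda>n. F n y) \<longlonglongrightarrow> G y"
  proof (rule order_tendstoI)
    fix a assume a: "a < G y"
    then obtain b where b: "b < y" "\<And>z. b < z \<Longrightarrow> z < y \<Longrightarrow> a < G z"
      using order_tendstoD(1)[OF filterlim_mono[OF G order_refl], of "at_left y" a]
      by (auto simp: at_le eventually_at_left_field)
    obtain z where z: "b < z" "z < y" using b(1) dense by blast
    obtain q where q: "q \<in> \<rat>" "z < q" "q < y" using Rats_dense_in_real[OF z(2)] by blast
    have "a < \<phi> q" using b(2)[OF z] above[OF q(1,2)] by simp
    from order_tendstoD(1)[OF conv[OF q(1)] this]
    show "\<forall>\<^sub>F n in sequentially. a < F n y"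
      by eventually_elim (use monoD[OF mono, of q y] q in \<open>force intro: less_le_trans\<close>)
  next
    fix a assume a: "G y < a"
    then obtain b where b: "y < b" "\<And>z. y < z \<Longrightarrow> z < b \<Longrightarrow> G z < a"
      using order_tendstoD(2)[OF filterlim_mono[OF G order_refl], of "at_right y" a]
      by (auto simp: at_le eventually_at_right_field)
    obtain q where q: "q \<in> \<rat>" "y < q" "q < b" using Rats_dense_in_real[OF b(1)] by blast
    have "\<phi> q < a" using b(2)[OF q(2,3)] below[OF q(1) order_refl] by simp
    from order_tendstoD(2)[OF conv[OF q(1)] this]
    show "\<forall>\<^sub>F n in sequentially. F n y < a"
      by eventually_elim (use monoD[OF mono, of y q] q in \<open>force intro: le_less_trans\<close>)
  qed
qed

text \<open>The infimum runs over rationals only, so that for a family of functions \<open>\<phi>\<close> that depend measurably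
  on a parameter it depends measurably on the parameter too.\<close>

definition right_regularization :: "(real \<Rightarrow> real) \<Rightarrow> real \<Rightarrow> real" where
  "right_regularization \<phi> y = (INF q\<in>{q\<in>\<rat>. y < q}. \<phi> q)"

context
  fixes \<phi> :: "real \<Rightarrow> real"
  assumes mono: "mono \<phi>" and nonpos: "\<And>q. q \<le> 0 \<Longrightarrow> \<phi> q = 0" and ge1: "\<And>q. 1 \<le> q \<Longrightarrow> \<phi> q = 1"
begin

lemma rationals_above_nonempty: "{q\<in>\<rat>. y < q} \<noteq> {}" for y :: real
  using Rats_dense_in_real[of y "y + 1"] by auto

lemma phi_nonneg: "0 \<le> \<phi> q"
  using monoD[OF mono, of "min q 0" q] nonpos[of "min q 0"] by simp

lemma right_regularization_le: "q \<in> \<rat> \<Longrightarrow> y < q \<Longrightarrow> right_regularization \<phi> y \<le> \<phi> q"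
  unfolding right_regularization_def
  by (rule cINF_lower) (auto intro!: bdd_belowI[of _ 0] phi_nonneg)

lemma right_regularization_ge: "q \<le> y \<Longrightarrow> \<phi> q \<le> right_regularization \<phi> y"
  unfolding right_regularization_def
  by (rule cINF_greatest[OF rationals_above_nonempty]) (auto intro: monoD[OF mono])

lemma mono_right_regularization: "x \<le> y \<Longrightarrow> right_regularization \<phi> x \<le> right_regularization \<phi> y"
  unfolding right_regularization_def
  by (rule cINF_superset_mono[OF rationals_above_nonempty])
    (auto intro!: bdd_belowI[of _ 0] phi_nonneg)

lemma right_regularization_neg: "y < 0 \<Longrightarrow> right_regularization \<phi> y = 0"
  using right_regularization_ge[of y y] right_regularization_le[of 0 y] nonpos by force

lemma right_regularization_ge_1:
  assumes "1 \<le> y" shows "right_regularization \<phi> y = 1"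
proof -
  obtain q where "q \<in> \<rat>" "y < q" using rationals_above_nonempty by blast
  then show ?thesis
    using right_regularization_ge[of y y] right_regularization_le[of q y] ge1[of y] ge1[of q] assms by auto
qed

lemma right_cont_right_regularization: "continuous (at_right a) (right_regularization \<phi>)"
proof (subst continuous_at_right_real_increasing[OF mono_right_regularization], simp, intro allI impI)
  fix e :: real assume "0 < e"
  then have "right_regularization \<phi> a < right_regularization \<phi> a + e" by simp
  then have "\<exists>z\<in>\<phi> ` {q\<in>\<rat>. a < q}. z < right_regularization \<phi> a + e"
    unfolding right_regularization_def using rationals_above_nonempty by (intro cInf_lessD) auto
  then obtain q where q: "q \<in> \<rat>" "a < q" "\<phi> q < right_regularization \<phi> a + e"
    by auto
  have "right_regularization \<phi> (a + (q - a) / 2) \<le> \<phi> q"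
    using q by (intro right_regularization_le) (auto simp: field_simps)
  then show "\<exists>d>0. right_regularization \<phi> (a + d) - right_regularization \<phi> a < e"
    using q by (intro exI[of _ "(q - a) / 2"]) auto
qed

lemma tendsto_right_regularization:
  "(right_regularization \<phi> \<longlongrightarrow> 0) at_bot" "(right_regularization \<phi> \<longlongrightarrow> 1) at_top"
proof -
  show "(right_regularization \<phi> \<longlongrightarrow> 0) at_bot"
    by (intro tendsto_eventually eventually_mono[OF eventually_gt_at_bot[of 0]] right_regularization_neg)
  show "(right_regularization \<phi> \<longlongrightarrow> 1) at_top"
    by (intro tendsto_eventually eventually_mono[OF eventually_ge_at_top[of 1]] right_regularization_ge_1)
qed

lemma real_distribution_right_regularization:
  "real_distribution (interval_measure (right_regularization \<phi>))"
  by (intro real_distribution_interval_measure mono_right_regularization right_cont_right_regularization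
      tendsto_right_regularization)

lemma emeasure_right_regularization_Iic:
  "emeasure (interval_measure (right_regularization \<phi>)) {..y} = ennreal (right_regularization \<phi> y)"
  by (intro emeasure_interval_measure_Iic mono_right_regularization right_cont_right_regularization
      tendsto_right_regularization)

end

section \<open>The limit kernel\<close>

definition unit_clamp :: "real \<Rightarrow> real" where "unit_clamp y = max 0 (min 1 y)"

lemma unit_clamp_01: "unit_clamp y \<in> {0..1}" by (simp add: unit_clamp_def)

lemma unit_clamp_id: "y \<in> {0..1} \<Longrightarrow> unit_clamp y = y" by (simp add: unit_clamp_def)

text \<open>The upper limit keeps monotonicity in \<open>q\<close> for every \<open>x\<close>, including those where the slopes diverge, so
  no exceptional set has to be removed. Clamping extends the slopes to the whole line as functions
  that vanish to the left of \<open>0\<close> and equal \<open>1\<close> to the right of \<open>1\<close>.\<close>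

definition limit_slope :: "(real \<Rightarrow> real \<Rightarrow> real) \<Rightarrow> (nat \<Rightarrow> nat) \<Rightarrow> real \<Rightarrow> real \<Rightarrow> real" where
  "limit_slope C N x q = real_of_ereal (limsup (\<lambda>k. ereal (slope C (N k) x (unit_clamp q))))"

text \<open>Pushing forward along \<^const>\<open>unit_clamp\<close> turns a probability measure on the line into one on the
  unit interval; for \<open>0 \<le> y < 1\<close> the image gives \<open>{0..y}\<close> the mass that \<open>{..y}\<close> had before.\<close>

definition limit_kernel :: "(real \<Rightarrow> real \<Rightarrow> real) \<Rightarrow> (nat \<Rightarrow> nat) \<Rightarrow> real \<Rightarrow> real measure" where
  "limit_kernel C N x =
    distr (interval_measure (right_regularization (limit_slope C N x))) unit_borel unit_clamp"

lemma measurable_unit_clamp: "unit_clamp \<in> borel \<rightarrow>\<^sub>M unit_borel"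
proof (rule measurable_restrict_space2)
  show "unit_clamp \<in> space borel \<rightarrow> {0..1}" using unit_clamp_01 by auto
  show "unit_clamp \<in> borel_measurable borel" unfolding unit_clamp_def by measurable
qed

text \<open>Copulas are increasing and Lipschitz with constant \<open>1\<close> in each argument: extending a thin strip to the
  full width of the square can only increase its mass, which is then given by the margins.\<close>

lemma copula_increment:
  assumes C: "copula C" and s: "0 \<le> s1" "s1 \<le> s2" "s2 \<le> 1" and y: "0 \<le> y1" "y1 \<le> y2" "y2 \<le> 1"
  shows "C s1 y1 \<le> C s2 y2" "C s2 y2 \<le> C s1 y1 + (s2 - s1) + (y2 - y1)"
proof -
  have rect: "0 \<le> C b d - C a d - C b c + C a c"
    if "0 \<le> a" "a \<le> b" "b \<le> 1" "0 \<le> c" "c \<le> d" "d \<le> 1" for a b c d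
    using C that unfolding copula_def by auto
  have margin: "C t 0 = 0" "C 0 t = 0" "C t 1 = t" "C 1 t = t" if "t \<in> {0..1}" for t
    using C that unfolding copula_def by auto
  show "C s1 y1 \<le> C s2 y2"
    using rect[of s1 s2 0 y2] rect[of 0 s1 y1 y2] s y margin[of s1] margin[of s2] margin[of y1] margin[of y2]
    by auto
  show "C s2 y2 \<le> C s1 y1 + (s2 - s1) + (y2 - y1)"
    using rect[of s1 s2 y2 1] rect[of s1 1 y1 y2] s y margin[of s1] margin[of s2] margin[of y1] margin[of y2]
    by auto
qed

lemma rational_on_factorial_grid:
  assumes "q \<in> \<rat>" "q \<in> {0..1}"
  shows "\<forall>\<^sub>F n in sequentially. \<exists>m\<le>fact n. q = real m / real (fact n)"
proof -
  obtain a b :: nat where ab: "b \<noteq> 0" "q = real a / real b"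
    using assms Rats_abs_nat_div_natE[of q] by (metis abs_of_nonneg atLeastAtMost_iff)
  show ?thesis
    using eventually_ge_at_top[of b]
  proof eventually_elim
    case (elim n)
    then obtain c where c: "fact n = b * c" using ab(1) dvd_fact[of b n] by (auto simp: dvd_def)
    have "c \<noteq> 0" using c by (metis fact_nonzero mult_0_right)
    then have "q = real (a * c) / real (fact n)" using ab unfolding c by simp
    moreover have "real a \<le> real b" using ab assms(2) by (simp add: divide_le_eq_1)
    then have "a \<le> b" by simp
    ultimately show ?case unfolding c by (metis mult_le_mono1)
  qed
qed

lemma rational_below:
  assumes "s \<in> {0..1::real}" "0 < e"
  obtains s1 where "s1 \<in> \<rat>" "s1 \<in> {0..1}" "s1 \<le> s" "s - s1 < e"
proof (cases "s = 0")
  case True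
  then show ?thesis using that[of 0] assms by auto
next
  case False
  then have "max 0 (s - e) < s" using assms by auto
  from Rats_dense_in_real[OF this] obtain s1 where "s1 \<in> \<rat>" "max 0 (s - e) < s1" "s1 < s" by blast
  then show ?thesis using that[of s1] assms by auto
qed

text \<open>Below \<open>1\<close> the approximation has to be strict, since the regularization at \<open>y\<close> is dominated only by
  values at rationals beyond \<open>y\<close>.\<close>

lemma rational_above:
  assumes "s \<in> {0..1::real}" "0 < e"
  obtains s2 where "s2 \<in> \<rat>" "s2 \<in> {0..1}" "s < s2 \<or> s = 1 \<and> s2 = 1" "s2 - s < e"
proof (cases "s = 1")
  case True
  then show ?thesis using that[of 1] assms by auto
next
  case False
  then have "s < min 1 (s + e)" using assms by auto
  from Rats_dense_in_real[OF this] obtain s2 where "s2 \<in> \<rat>" "s < s2" "s2 < min 1 (s + e)" by blast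
  then show ?thesis using that[of s2] assms by auto
qed

lemma cdf_unit_borel:
  assumes "prob_space \<mu>" "sets \<mu> = sets unit_borel"
  shows "cdf (distr \<mu> borel (\<lambda>y. y)) y = (if y < 0 then 0 else measure \<mu> {0..min 1 y})"
proof -
  have space: "space \<mu> = {0..1}" using sets_eq_imp_space_eq[OF assms(2)] by (simp add: space_restrict_space)
  have "(\<lambda>y. y) \<in> \<mu> \<rightarrow>\<^sub>M borel"
    using measurable_restrict_space1[of "\<lambda>y. y" borel borel "{0..1}"] measurable_cong_sets[OF assms(2) refl] by auto
  then have "cdf (distr \<mu> borel (\<lambda>y. y)) y = measure \<mu> ({..y} \<inter> {0..1})"
    by (simp add: cdf_def measure_distr space)
  also have "{..y} \<inter> {0..1} = (if y < 0 then {} else {0..min 1 y})" by auto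
  finally show ?thesis by simp
qed

context
  fixes C :: "real \<Rightarrow> real \<Rightarrow> real" and N :: "nat \<Rightarrow> nat"
  assumes C: "copula C" and N_pos: "\<And>k. 0 < N k"
begin

lemma limsup_slope_bounds:
  "0 \<le> limsup (\<lambda>k. ereal (slope C (N k) x (unit_clamp q)))"
  "limsup (\<lambda>k. ereal (slope C (N k) x (unit_clamp q))) \<le> 1"
  using slope_bounds[OF C N_pos unit_clamp_01]
  by (auto intro!: le_Limsup Limsup_bounded always_eventually simp: one_ereal_def zero_ereal_def)

lemma limit_slope_bounds: "limit_slope C N x q \<in> {0..1}"
  using limsup_slope_bounds[of x q] unfolding limit_slope_def
  by (cases "limsup (\<lambda>k. ereal (slope C (N k) x (unit_clamp q)))") auto

lemma mono_limit_slope: "mono (limit_slope C N x)"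
proof (rule monoI)
  fix p q :: real assume "p \<le> q"
  then have "unit_clamp p \<le> unit_clamp q" by (auto simp: unit_clamp_def)
  then have "slope C (N k) x (unit_clamp p) \<le> slope C (N k) x (unit_clamp q)" for k
    using unit_clamp_01[of p] unit_clamp_01[of q] by (intro slope_mono[OF C N_pos]) auto
  then have "limsup (\<lambda>k. ereal (slope C (N k) x (unit_clamp p)))
      \<le> limsup (\<lambda>k. ereal (slope C (N k) x (unit_clamp q)))"
    by (intro Limsup_mono always_eventually) auto
  then show "limit_slope C N x p \<le> limit_slope C N x q"
    unfolding limit_slope_def using limsup_slope_bounds(1)[of x p] limsup_slope_bounds(2)[of x q]
    by (intro real_of_ereal_positive_mono) auto
qed

lemma limit_slope_nonpos: "q \<le> 0 \<Longrightarrow> limit_slope C N x q = 0"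
  by (simp add: limit_slope_def unit_clamp_def slope_0[OF C N_pos] Limsup_const)

lemma limit_slope_ge_1: "1 \<le> q \<Longrightarrow> limit_slope C N x q = 1"
  by (simp add: limit_slope_def unit_clamp_def slope_1[OF C N_pos] Limsup_const)

lemma measurable_limit_slope [measurable]: "(\<lambda>x. limit_slope C N x q) \<in> borel_measurable unit_lebesgue"
  unfolding limit_slope_def by measurable

lemma LIMSEQ_limit_slope:
  assumes "convergent (\<lambda>k. slope C (N k) x q)" "q \<in> {0..1}"
  shows "(\<lambda>k. slope C (N k) x q) \<longlonglongrightarrow> limit_slope C N x q"
proof -
  obtain l where l: "(\<lambda>k. slope C (N k) x q) \<longlonglongrightarrow> l" using assms(1) by (auto simp: convergent_def)
  then have "limsup (\<lambda>k. ereal (slope C (N k) x q)) = ereal l"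
    by (intro lim_imp_Limsup) auto
  then show ?thesis using l by (simp add: limit_slope_def unit_clamp_id[OF assms(2)])
qed

abbreviation limit_cdf :: "real \<Rightarrow> real \<Rightarrow> real" where
  "limit_cdf x \<equiv> right_regularization (limit_slope C N x)"

lemmas limit_slope_props = mono_limit_slope limit_slope_nonpos limit_slope_ge_1

lemma measurable_limit_cdf: "(\<lambda>x. limit_cdf x y) \<in> borel_measurable unit_lebesgue"
proof -
  have "countable {q\<in>\<rat>. y < (q::real)}"
    by (rule countable_subset[OF _ countable_rat]) auto
  then show ?thesis
    unfolding right_regularization_def
    by (intro borel_measurable_cINF_real measurable_limit_slope)
qed

lemma limit_cdf_bounds: "limit_cdf x y \<in> {0..1}"
  using right_regularization_ge[OF limit_slope_props, of "y" y x] limit_slope_bounds[of x y]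
    mono_right_regularization[OF limit_slope_props, of y "max y 1" x] right_regularization_ge_1[OF limit_slope_props, of "max y 1" x]
  by auto

lemma limit_kernel_measurable: "limit_kernel C N \<in> unit_borel \<rightarrow>\<^sub>M prob_algebra unit_borel"
proof -
  have "(\<lambda>x. interval_measure (limit_cdf x)) \<in> unit_borel \<rightarrow>\<^sub>M prob_algebra borel"
  proof (rule measurable_prob_algebra_generated[where \<Omega>=UNIV and G="range atMost"])
    show "sets (borel :: real measure) = sigma_sets UNIV (range atMost)"
      unfolding borel_eq_atMost by simp
    show "Int_stable (range atMost :: real set set)"
      by (auto simp: Int_stable_def)
    show "prob_space (interval_measure (limit_cdf x))" for x
      using real_distribution_right_regularization[OF limit_slope_props] by (rule real_distribution.axioms)
    fix A :: "real set" assume "A \<in> range atMost"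
    then obtain y where A: "A = {..y}" by auto
    have "(\<lambda>x. ennreal (limit_cdf x y)) \<in> borel_measurable unit_borel"
      using measurable_compose[OF measurable_limit_cdf measurable_ennreal]
      by (simp add: measurable_cong_sets[OF sets_unit_lebesgue refl])
    then show "(\<lambda>x. emeasure (interval_measure (limit_cdf x)) A) \<in> borel_measurable unit_borel"
      by (simp add: A emeasure_right_regularization_Iic[OF limit_slope_props])
  qed auto
  from measurable_compose[OF this measurable_distr_prob_space[OF measurable_unit_clamp]]
  show ?thesis unfolding limit_kernel_def .
qed

lemma emeasure_limit_kernel:
  assumes y: "y \<in> {0..1}"
  shows "emeasure (limit_kernel C N x) {0..y} = ennreal (limit_cdf x y)"
proof -
  interpret real_distribution "interval_measure (limit_cdf x)"
    by (rule real_distribution_right_regularization[OF limit_slope_props])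
  have "emeasure (limit_kernel C N x) {0..y} = emeasure (interval_measure (limit_cdf x)) (unit_clamp -` {0..y})"
    unfolding limit_kernel_def using y measurable_unit_clamp
    by (subst emeasure_distr) (auto simp: sets_restrict_space_iff measurable_cong_sets[OF sets_interval_measure refl])
  also have "\<dots> = ennreal (limit_cdf x y)"
  proof (cases "y = 1")
    case True
    then have "unit_clamp -` {0..y} = space (interval_measure (limit_cdf x))" using unit_clamp_01 by auto
    then show ?thesis using True right_regularization_ge_1[OF limit_slope_props, of 1 x] emeasure_space_1 by simp
  next
    case False
    then have "unit_clamp -` {0..y} = {..y}" using y by (auto simp: unit_clamp_def)
    then show ?thesis using emeasure_right_regularization_Iic[OF limit_slope_props, of x y] by simp
  qed
  finally show ?thesis .
qed

context
  assumes eventually_grid: "\<And>q. q \<in> \<rat> \<Longrightarrow> q \<in> {0..1} \<Longrightarrow>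
      \<forall>\<^sub>F k in sequentially. \<exists>m\<le>N k. q = real m / real (N k)"
    and conv: "\<And>q. q \<in> \<rat> \<Longrightarrow> q \<in> {0..1} \<Longrightarrow>
      AE x in unit_lebesgue. convergent (\<lambda>k. slope C (N k) x q)"
begin

text \<open>For a grid point \<open>s\<close> the integral of the slopes over \<open>{0..s}\<close> telescopes to \<open>C s q\<close>, and a rational
  \<open>s\<close> is eventually a grid point, so the claim follows by dominated convergence.\<close>

lemma integral_limit_slope:
  assumes s: "s \<in> \<rat>" "s \<in> {0..1}" and q: "q \<in> \<rat>" "q \<in> {0..1}"
  shows "(\<integral>t. limit_slope C N t q * indicator {0..s} t \<partial>unit_lebesgue) = C s q"
proof (rule LIMSEQ_unique)
  interpret prob_space unit_lebesgue by (rule prob_space_unit_lebesgue)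
  have sets: "{0..s} \<in> sets unit_lebesgue" using s by (simp add: sets_restrict_space_iff)
  show "(\<lambda>k. \<integral>t. slope C (N k) t q * indicator {0..s} t \<partial>unit_lebesgue)
      \<longlonglongrightarrow> (\<integral>t. limit_slope C N t q * indicator {0..s} t \<partial>unit_lebesgue)"
  proof (rule integral_dominated_convergence[where w="\<lambda>_. 1"])
    show "AE t in unit_lebesgue. (\<lambda>k. slope C (N k) t q * indicator {0..s} t)
        \<longlonglongrightarrow> limit_slope C N t q * indicator {0..s} t"
      using conv[OF q] by eventually_elim (intro tendsto_intros LIMSEQ_limit_slope[OF _ q(2)])
    show "AE t in unit_lebesgue. norm (slope C (N k) t q * indicator {0..s} t) \<le> 1" for k
      using slope_bounds[OF C N_pos q(2)] by (auto simp: indicator_def)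
  qed (use sets in \<open>auto intro!: borel_measurable_times measurable_limit_slope measurable_slope\<close>)
  have "\<forall>\<^sub>F k in sequentially. (\<integral>t. slope C (N k) t q * indicator {0..s} t \<partial>unit_lebesgue) = C s q"
    using eventually_grid[OF s] by eventually_elim (auto simp: integral_slope_upto[OF C N_pos _ q(2)])
  then show "(\<lambda>k. \<integral>t. slope C (N k) t q * indicator {0..s} t \<partial>unit_lebesgue) \<longlonglongrightarrow> C s q"
    by (rule tendsto_eventually)
qed

text \<open>The integral over \<open>{0..s}\<close> of the regularized distribution function at \<open>y\<close> lies between \<open>C s1 y1\<close>
  and \<open>C s2 y2\<close> for rationals just below and above \<open>s\<close> and \<open>y\<close>. By the Lipschitz property
  these bounds are arbitrarily close to \<open>C s y\<close>.\<close>

lemma markov_kernel_limit_kernel: "markov_kernel C (limit_kernel C N)"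
proof (rule markov_kernelI[OF limit_kernel_measurable])
  interpret prob_space unit_lebesgue by (rule prob_space_unit_lebesgue)
  fix s y :: real assume s: "s \<in> {0..1}" and y: "y \<in> {0..1}"
  let ?G = "\<lambda>t. right_regularization (limit_slope C N t)" and ?\<phi> = "limit_slope C N"
  have sets: "{0..s} \<in> sets unit_lebesgue" if "s \<in> {0..1}" for s :: real
    using that by (simp add: sets_restrict_space_iff)
  have int_G: "integrable unit_lebesgue (\<lambda>t. ?G t y * indicator {0..s} t)"
    using limit_cdf_bounds
    by (intro integrable_real_mult_indicator sets s integrable_const_bound[of _ 1] measurable_limit_cdf) auto
  have int_\<phi>: "integrable unit_lebesgue (\<lambda>t. ?\<phi> t q * indicator {0..s} t)" if "s \<in> {0..1}" for q s
    using limit_slope_bounds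
    by (intro integrable_real_mult_indicator sets that integrable_const_bound[of _ 1] measurable_limit_slope) auto
  define I where "I = (\<integral>t. ?G t y * indicator {0..s} t \<partial>unit_lebesgue)"
  have "\<bar>I - C s y\<bar> \<le> e" if e: "0 < e" for e
  proof -
    have e2: "0 < e / 2" using e by simp
    obtain s1 where s1: "s1 \<in> \<rat>" "s1 \<in> {0..1}" "s1 \<le> s" "s - s1 < e / 2" using rational_below[OF s e2] .
    obtain y1 where y1: "y1 \<in> \<rat>" "y1 \<in> {0..1}" "y1 \<le> y" "y - y1 < e / 2" using rational_below[OF y e2] .
    obtain s2 where s2: "s2 \<in> \<rat>" "s2 \<in> {0..1}" "s < s2 \<or> s = 1 \<and> s2 = 1" "s2 - s < e / 2"
      using rational_above[OF s e2] .
    obtain y2 where y2: "y2 \<in> \<rat>" "y2 \<in> {0..1}" "y < y2 \<or> y = 1 \<and> y2 = 1" "y2 - y < e / 2"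
      using rational_above[OF y e2] .
    have lower: "?\<phi> t y1 \<le> ?G t y" for t
      by (rule right_regularization_ge[OF limit_slope_props y1(3)])
    have upper: "?G t y \<le> ?\<phi> t y2" for t
      using y2(3) right_regularization_le[OF limit_slope_props y2(1), of y t] right_regularization_ge_1[OF limit_slope_props, of 1 t] limit_slope_ge_1[of 1 t]
      by auto
    have "C s1 y1 \<le> I"
      unfolding I_def integral_limit_slope[OF s1(1,2) y1(1,2), symmetric]
    proof (rule integral_mono[OF int_\<phi>[OF s1(2)] int_G])
      fix t
      have "0 \<le> ?\<phi> t y1" "0 \<le> ?G t y" using limit_slope_bounds[of t y1] lower[of t] by auto
      then show "?\<phi> t y1 * indicator {0..s1} t \<le> ?G t y * indicator {0..s} t"
        using lower[of t] s1(3) by (auto simp: indicator_def)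
    qed
    moreover have "I \<le> C s2 y2"
      unfolding I_def integral_limit_slope[OF s2(1,2) y2(1,2), symmetric]
    proof (rule integral_mono[OF int_G int_\<phi>[OF s2(2)]])
      fix t
      have "0 \<le> ?\<phi> t y2" using limit_slope_bounds[of t y2] by auto
      then show "?G t y * indicator {0..s} t \<le> ?\<phi> t y2 * indicator {0..s2} t"
        using upper[of t] s2(3) by (auto simp: indicator_def)
    qed
    moreover have "C s y \<le> C s1 y1 + (s - s1) + (y - y1)"
      using s1 y1 s y by (intro copula_increment[OF C]) auto
    moreover have "C s2 y2 \<le> C s y + (s2 - s) + (y2 - y)"
      using s2 y2 s y by (intro copula_increment[OF C]) auto
    ultimately show ?thesis using s1 y1 s2 y2 by linarith
  qed
  then have "\<bar>I - C s y\<bar> \<le> 0" using field_le_epsilon[of "\<bar>I - C s y\<bar>" 0] by simp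
  then have I: "I = C s y" by simp
  have "(\<integral>\<^sup>+ t\<in>{0..s}. emeasure (limit_kernel C N t) {0..y} \<partial>unit_lebesgue)
      = (\<integral>\<^sup>+ t. ennreal (?G t y * indicator {0..s} t) \<partial>unit_lebesgue)"
    by (intro nn_integral_cong) (auto simp: emeasure_limit_kernel[OF y] indicator_def)
  also have "\<dots> = ennreal I"
    unfolding I_def using limit_cdf_bounds by (intro nn_integral_eq_integral int_G) auto
  finally show "(\<integral>\<^sup>+ t\<in>{0..s}. emeasure (limit_kernel C N t) {0..y} \<partial>unit_lebesgue) = ennreal (C s y)"
    unfolding I .
qed

lemma cdf_limit_kernel:
  assumes x: "x \<in> {0..1}"
  shows "cdf (distr (limit_kernel C N x) borel (\<lambda>y. y)) y = right_regularization (limit_slope C N x) y"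
proof -
  let ?G = "right_regularization (limit_slope C N x)"
  note K = kernel_space[OF limit_kernel_measurable x]
  have "measure (limit_kernel C N x) {0..min 1 y} = ?G (min 1 y)" if "0 \<le> y"
    using emeasure_limit_kernel[of "min 1 y" x] that limit_cdf_bounds[of x "min 1 y"]
    by (simp add: measure_def)
  moreover have "?G (min 1 y) = ?G y"
    using right_regularization_ge_1[OF limit_slope_props, of y x] right_regularization_ge_1[OF limit_slope_props, of 1 x] by (auto simp: min_def)
  ultimately show ?thesis
    unfolding cdf_unit_borel[OF K] using right_regularization_neg[OF limit_slope_props, of y x] by auto
qed

lemma cdf_checkerboard_kernel_grid:
  assumes x: "x \<in> {0..1}" and M: "0 < M" and grid: "m \<le> M" "unit_clamp q = real m / real M"
  shows "cdf (distr (checkerboard_kernel C M x) borel (\<lambda>y. y)) q = slope C M x (unit_clamp q)"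
proof -
  note K = kernel_space[OF checkerboard_kernel_measurable[OF C M] x]
  show ?thesis
  proof (cases "q < 0")
    case True
    then show ?thesis unfolding cdf_unit_borel[OF K] using slope_0[OF C M] by (simp add: unit_clamp_def)
  next
    case False
    then have "unit_clamp q = min 1 q" by (simp add: unit_clamp_def)
    then show ?thesis
      unfolding cdf_unit_borel[OF K] using False grid emeasure_checkerboard_kernel_grid[OF C M grid(1), of x]
        slope_bounds[OF C M unit_clamp_01, of x q]
      by (simp add: measure_def)
  qed
qed

lemma wcc_checkerboard: "wcc (\<lambda>k. checkerboard C (N k)) C"
  unfolding wcc_def
proof (intro exI conjI allI)
  show "markov_kernel C (limit_kernel C N)" by (rule markov_kernel_limit_kernel)
  show "markov_kernel (checkerboard C (N k)) (checkerboard_kernel C (N k))" for k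
    by (rule markov_kernel_checkerboard[OF C N_pos])
  have "AE x in unit_lebesgue. \<forall>q\<in>\<rat> \<inter> {0..1}. convergent (\<lambda>k. slope C (N k) x q)"
    using conv by (subst AE_ball_countable) (auto intro: countable_subset[OF _ countable_rat])
  then show "AE x in unit_lebesgue. weak_conv_m (\<lambda>k. distr (checkerboard_kernel C (N k) x) borel (\<lambda>y. y))
      (distr (limit_kernel C N x) borel (\<lambda>y. y))"
    using AE_space
  proof eventually_elim
    case (elim x)
    then have x: "x \<in> {0..1}" by (simp add: space_restrict_space)
    show ?case
      unfolding weak_conv_m_def
    proof (rule weak_conv_rational[where \<phi>="limit_slope C N x"])
      fix k
      note K = kernel_space[OF checkerboard_kernel_measurable[OF C N_pos] x]
      interpret prob_space "checkerboard_kernel C (N k) x" by (rule K)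
      show "mono (cdf (distr (checkerboard_kernel C (N k) x) borel (\<lambda>y. y)))"
        unfolding cdf_unit_borel[OF K] using K(2)
        by (auto simp: mono_def sets_restrict_space_iff intro!: finite_measure_mono)
    next
      fix q :: real assume q: "q \<in> \<rat>"
      let ?q = "unit_clamp q"
      have q': "?q \<in> \<rat>" "?q \<in> {0..1}" using q unit_clamp_01 by (auto simp: unit_clamp_def max_def min_def)
      have "(\<lambda>k. slope C (N k) x ?q) \<longlonglongrightarrow> limit_slope C N x ?q"
        using elim q' by (intro LIMSEQ_limit_slope) auto
      moreover have ev: "\<forall>\<^sub>F k in sequentially.
          cdf (distr (checkerboard_kernel C (N k) x) borel (\<lambda>y. y)) q = slope C (N k) x ?q"
        using eventually_grid[OF q'] by eventually_elim (use cdf_checkerboard_kernel_grid[OF x N_pos] in blast)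
      moreover have "limit_slope C N x ?q = limit_slope C N x q"
        unfolding limit_slope_def by (simp add: unit_clamp_id[OF unit_clamp_01])
      ultimately show "(\<lambda>k. cdf (distr (checkerboard_kernel C (N k) x) borel (\<lambda>y. y)) q) \<longlonglongrightarrow> limit_slope C N x q"
        unfolding tendsto_cong[OF ev] by simp
    next
      fix q y :: real
      show "limit_slope C N x q \<le> cdf (distr (limit_kernel C N x) borel (\<lambda>y. y)) y" if "q \<le> y"
        unfolding cdf_limit_kernel[OF x] by (rule right_regularization_ge[OF limit_slope_props that])
      show "cdf (distr (limit_kernel C N x) borel (\<lambda>y. y)) y \<le> limit_slope C N x q" if "q \<in> \<rat>" "y < q"
        unfolding cdf_limit_kernel[OF x] by (rule right_regularization_le[OF limit_slope_props that])
    qed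
  qed
qed

end

end

section \<open>Density of the checkerboard copulas\<close>

lemma common_convergent_subseq_slope:
  assumes C: "copula C"
  obtains r :: "nat \<Rightarrow> nat" where "strict_mono r"
    "\<And>q. q \<in> \<rat> \<Longrightarrow> q \<in> {0..1} \<Longrightarrow> AE x in unit_lebesgue. convergent (\<lambda>k. slope C (fact (r k)) x q)"
proof -
  interpret prob_space unit_lebesgue by (rule prob_space_unit_lebesgue)
  have "countable (\<rat> \<inter> {0..1::real})" by (rule countable_subset[OF Int_lower1 countable_rat])
  moreover have "0 \<in> \<rat> \<inter> {0..1::real}" by simp
  ultimately obtain e :: "nat \<Rightarrow> real" where e: "\<rat> \<inter> {0..1} = range e"
    using uncountable_def by (metis empty_iff)
  define u where "u j n x = slope C (fact n) x (e j)" for j n x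
  have e01: "e j \<in> {0..1}" for j using e by blast
  have bound: "\<bar>u j n x\<bar> \<le> 1" for j n x
    using slope_bounds[OF C _ e01[of j], of "fact n" x] unfolding u_def by simp
  have meas: "u j n \<in> borel_measurable unit_lebesgue" for j n
    unfolding u_def[abs_def] by (rule measurable_slope)
  have cauchy: "\<exists>N. \<forall>m\<ge>N. \<forall>n\<ge>N. (\<integral>x. norm (u j m x - u j n x) \<partial>unit_lebesgue) < d" if "0 < d" for j d
  proof (rule bounded_orthogonal_increments_L1_Cauchy[where u="u j" and B=1, OF meas bound _ that])
    fix n m :: nat assume "n \<le> m"
    then obtain k where k: "fact m = fact n * (k::nat)" using fact_dvd[of n m] unfolding dvd_def by blast
    then have "0 < k" using fact_gt_zero[of m] by (cases k) auto
    then show "(\<integral>x. u j m x * u j n x \<partial>unit_lebesgue) = (\<integral>x. (u j n x)\<^sup>2 \<partial>unit_lebesgue)"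
      unfolding u_def k by (intro integral_slope_mult_refine) auto
  qed
  have int: "integrable unit_lebesgue (u j n)" for j n
    using bound meas by (intro integrable_const_bound[of _ 1]) auto
  obtain r where r: "strict_mono r" "\<And>j. AE x in unit_lebesgue. convergent (\<lambda>k. u j (r k) x)"
    by (rule AE_convergent_common_subseq[where M=unit_lebesgue and u=u, OF int cauchy]) (assumption | rule that)+
  show ?thesis
  proof (rule that[OF r(1)])
    fix q :: real assume "q \<in> \<rat>" "q \<in> {0..1}"
    then obtain j where "q = e j" using e by blast
    then show "AE x in unit_lebesgue. convergent (\<lambda>k. slope C (fact (r k)) x q)"
      using r(2)[of j] unfolding u_def by simp
  qed
qed

theorem theorem3p2:
  fixes C :: "real \<Rightarrow> real \<Rightarrow> real"
  assumes "copula C"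
  shows "\<exists>Cs :: nat \<Rightarrow> real \<Rightarrow> real \<Rightarrow> real.
    (\<forall>n. Cs n \<in> checkerboard_copulas) \<and> wcc Cs C"
proof -
  obtain r :: "nat \<Rightarrow> nat" where "strict_mono r"
    "\<And>q. q \<in> \<rat> \<Longrightarrow> q \<in> {0..1} \<Longrightarrow> AE x in unit_lebesgue. convergent (\<lambda>k. slope C (fact (r k)) x q)"
    using common_convergent_subseq_slope[OF assms] by blast
  note r = this
  have "wcc (\<lambda>k. checkerboard C (fact (r k))) C"
  proof (rule wcc_checkerboard[OF assms])
    show "\<forall>\<^sub>F k in sequentially. \<exists>m\<le>fact (r k). q = real m / real (fact (r k))"
      if "q \<in> \<rat>" "q \<in> {0..1}" for q
      using eventually_compose_filterlim[OF rational_on_factorial_grid[OF that] filterlim_subseq[OF r(1)]] .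
  qed (use r(2) in auto)
  moreover have "checkerboard C (fact (r k)) \<in> checkerboard_copulas" for k
    by (rule checkerboard_in_checkerboard_copulas[OF assms]) simp
  ultimately show ?thesis by (intro exI[of _ "\<lambda>k. checkerboard C (fact (r k))"] conjI allI)
qed

end
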